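(* Let $n\ge 2$. For every $\mathcal{S}=\{\lambda^1,\dots,\lambda^v\}\in\mathcal{T}_n$ put $\mathcal{G}_{\mathcal{S}}=\mathcal{G}_{\lambda^1}\cup\mathcal{G}_{\lambda^2}\cup\cdots\cup\mathcal{G}_{\lambda^v}$. Then the map $$\mathcal{S}=\{\lambda^1,\dots,\lambda^v\}\longmapsto \mathcal{G}_{\mathcal{S}}$$ is a bijection between $\mathcal{T}_n$ and the set of all $S_n$-invariant building sets $\mathcal{B}$ associated to the root arrangement $A_{n-1}$ which contain $\mathcal{F}_{A_{n-1}}$, i.e. with $\mathcal{F}_{A_{n-1}}\subseteq\mathcal{B}\subseteq\mathcal{C}_{A_{n-1}}$. (In particular each $\mathcal{G}_{\mathcal{S}}$ is an $S_n$-invariant building set.)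
   Context: Building sets. For a finite set $\mathcal{G}$ of nonzero subspaces of a finite-dimensional dual vector space $V^*$, let $\mathcal{C}_{\mathcal{G}}$ be its closure under sums (all sums of nonempty subfamilies). $\mathcal{G}$ is building if every $C\in\mathcal{C}_{\mathcal{G}}$ is the direct sum of the maximal (for inclusion) elements of $\mathcal{G}$ contained in $C$. Type $A_{n-1}$. Let $V=\mathbb{C}^n$ with coordinate functions $x_1,\dots,x_n\in V^*$; $S_n$ permutes the coordinates. Let $\mathcal{C}_{A_{n-1}}$ be the set of all nonzero subspaces of $V^*$ which are sums of lines spanned by vectors $x_i-x_j$ ($i\ne j$). Its elements correspond bijectively to the set partitions of $\{1,\dots,n\}$ having at least one part with more than one element: a partition corresponds to the span of all $x_a-x_b$ with $a,b$ in the same part. The subspace has the form $\lambda$, where $\lambda$ is the integer partition of $n$ given by the cardinalities of the parts. Let $\mathcal{F}_{A_{n-1}}\subseteq\mathcal{C}_{A_{n-1}}$ be the subset of subspaces (the irreducibles) whose set partition has exactly one part with more than one element. Order on partitions. Let $\Lambda_n$ be the set of partitions of $n$, represented by Young diagrams. The admissible moves on a diagram are: (a) remove an entire row and add all its boxes to another row which has at least two boxes, then rearrange the rows to obtain a Young diagram; (b) remove $k\ge2$ rows made by a single box and form a row made by $k$ boxes, provided $k$ is greater than or equal to the number of boxes of the smallest row with more than one box, then rearrange the rows. (If $\lambda=(1,1,\dots,1)$ no move is admissible.) For $\lambda,\mu\in\Lambda_n$ write $\lambda>\mu$ if $\lambda\neq\mu$ and $\lambda$ is obtained from $\mu$ by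 a sequence of admissible moves; $\lambda\geq\mu$ means $\lambda>\mu$ or $\lambda=\mu$. This is a partial order. Building partitions. $B\Lambda_n\subseteq\Lambda_n$ consists of $(n)$ together with all partitions of $n$ having at least two parts greater than or equal to $2$, with the induced order. For $\lambda\in B\Lambda_n$, let $\widetilde{\mathcal{G}}_\lambda$ be the set of all subspaces in $\mathcal{C}_{A_{n-1}}$ of the form $\gamma$ for some $\gamma\in\Lambda_n$ with $\gamma\geq\lambda$, and let $\mathcal{G}_\lambda=\mathcal{F}_{A_{n-1}}\cup\widetilde{\mathcal{G}}_\lambda$. $\mathcal{T}_n$ is the set whose elements are the nonempty sets of pairwise not comparable elements of $B\Lambda_n$. *)

theory Defs
  imports "HOL-Analysis.Analysis" "HOL-Library.Function_Algebras" "HOL-Library.Disjoint_Sets"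
    "HOL-Library.Multiset" "HOL-Combinatorics.Permutations"
begin

text \<open>
  The coordinates of \<open>V = \<complex>\<^sup>n\<close> are indexed by a finite type \<open>'n\<close> with \<open>CARD('n) = n\<close>.
  An element of the dual \<open>V\<^sup>*\<close> is a linear functional, as a plain HOL function; addition of
  functionals is the pointwise one from \<open>Function_Algebras\<close>.
\<close>

type_synonym 'n functional = "complex ^ 'n \<Rightarrow> complex"

definition dual_scale :: "complex \<Rightarrow> 'n::finite functional \<Rightarrow> 'n functional" where
  "dual_scale c f = (\<lambda>v. c * f v)"

global_interpretation dual: vector_space "dual_scale :: complex \<Rightarrow> 'n::finite functional \<Rightarrow> 'n functional"
  by unfold_locales (auto simp: dual_scale_def fun_eq_iff algebra_simps)

definition dual_space :: "'n::finite functional set" where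
  "dual_space = {f. Vector_Spaces.linear (*s) (*) f}"

definition coord :: "'n::finite \<Rightarrow> 'n functional" where
  "coord i = (\<lambda>v. v $ i)"

subsection \<open>Building sets\<close>

text \<open>
  The two notions below are applied to finite families \<open>M\<close> of subspaces only (HOL sums over an
  infinite index set are 0). The sum of \<open>M\<close> is the image of the summation map
  \<open>(u\<^sub>U)\<^sub>U \<mapsto> \<Sum>\<^sub>U u\<^sub>U\<close> on the product of the members of \<open>M\<close>; \<open>C\<close> is the (internal) direct sum of
  \<open>M\<close> if this map is a bijection onto \<open>C\<close>.
\<close>

definition sum_of :: "'n::finite functional set set \<Rightarrow> 'n functional set" where
  "sum_of M = (\<lambda>u. \<Sum>U\<in>M. u U) ` (\<Pi>\<^sub>E U\<in>M. U)"

definition is_direct_sum :: "'n::finite functional set \<Rightarrow> 'n functional set set \<Rightarrow> bool" where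
  "is_direct_sum C M \<longleftrightarrow> bij_betw (\<lambda>u. \<Sum>U\<in>M. u U) (\<Pi>\<^sub>E U\<in>M. U) C"

definition sum_closure :: "'n::finite functional set set \<Rightarrow> 'n functional set set" where
  "sum_closure G = {sum_of M |M. M \<subseteq> G \<and> M \<noteq> {}}"

definition max_elements_in :: "'n::finite functional set set \<Rightarrow> 'n functional set \<Rightarrow> 'n functional set set" where
  "max_elements_in G C = {A \<in> G. A \<subseteq> C \<and> (\<forall>B\<in>G. B \<subseteq> C \<longrightarrow> A \<subseteq> B \<longrightarrow> A = B)}"

definition building :: "'n::finite functional set set \<Rightarrow> bool" where
  "building G \<longleftrightarrow>
     finite G \<and> (\<forall>U\<in>G. U \<subseteq> dual_space \<and> dual.subspace U \<and> U \<noteq> {0}) \<and>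
     (\<forall>C\<in>sum_closure G. is_direct_sum C (max_elements_in G C))"

subsection \<open>Type \<open>A\<^bsub>n-1\<^esub>\<close>\<close>

definition root_lines :: "'n::finite functional set set" where
  "root_lines = {dual.span {coord i - coord j} |i j. i \<noteq> j}"

definition C_A :: "'n::finite functional set set" where
  "C_A = {U. U \<noteq> {0} \<and> (\<exists>M \<subseteq> root_lines. U = sum_of M)}"

definition partition_subspace :: "'n::finite set set \<Rightarrow> 'n functional set" where
  "partition_subspace P = dual.span {coord a - coord b |a b. \<exists>B\<in>P. a \<in> B \<and> b \<in> B}"

definition F_A :: "'n::finite functional set set" where
  "F_A = {U \<in> C_A. \<exists>P. partition_on UNIV P \<and> U = partition_subspace P \<and> (\<exists>!B. B \<in> P \<and> card B > 1)}"

definition has_form :: "'n::finite functional set \<Rightarrow> nat multiset \<Rightarrow> bool" where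
  "has_form U l \<longleftrightarrow>
     (\<exists>P. partition_on UNIV P \<and> U = partition_subspace P \<and> l = image_mset card (mset_set P))"

text \<open>
  A permutation \<open>\<sigma>\<close> acts on \<open>V\<close> by \<open>(\<sigma> v)\<^bsub>\<sigma> i\<^esub> = v\<^sub>i\<close> and on \<open>V\<^sup>*\<close> by \<open>(\<sigma> f)(v) = f (\<sigma>\<^sup>-\<^sup>1 v)\<close>;
  thus \<open>\<sigma> x\<^sub>i = x\<^bsub>\<sigma> i\<^esub>\<close>.
\<close>

definition perm_act :: "('n \<Rightarrow> 'n) \<Rightarrow> 'n::finite functional \<Rightarrow> 'n functional" where
  "perm_act \<sigma> f = (\<lambda>v. f (\<chi> i. v $ \<sigma> i))"

lemma perm_act_coord: "perm_act \<sigma> (coord i) = coord (\<sigma> i)"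
  by (simp add: perm_act_def coord_def)

definition S_n_invariant :: "'n::finite functional set set \<Rightarrow> bool" where
  "S_n_invariant G \<longleftrightarrow> (\<forall>\<sigma>. \<sigma> permutes UNIV \<longrightarrow> (\<forall>U\<in>G. perm_act \<sigma> ` U \<in> G))"

subsection \<open>Integer partitions\<close>

text \<open>A partition, or Young diagram, is the multiset of its (positive) row lengths.\<close>

definition Partitions :: "nat \<Rightarrow> nat multiset set" where
  "Partitions n = {l. (\<forall>k\<in>#l. k > 0) \<and> sum_mset l = n}"

text \<open>\<open>admissible_move m l\<close>: the diagram \<open>l\<close> results from \<open>m\<close> by one admissible move.\<close>

inductive admissible_move :: "nat multiset \<Rightarrow> nat multiset \<Rightarrow> bool" where
  join_rows: "b \<ge> 2 \<Longrightarrow> admissible_move (N + {#a, b#}) (N + {#a + b#})"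
| join_boxes: "k \<ge> 2 \<Longrightarrow> m = N + replicate_mset k 1 \<Longrightarrow> \<exists>r\<in>#m. r > 1 \<Longrightarrow>
    k \<ge> Min {r. r \<in># m \<and> r > 1} \<Longrightarrow> admissible_move m (N + {#k#})"

definition partition_gt :: "nat multiset \<Rightarrow> nat multiset \<Rightarrow> bool" where
  "partition_gt l m \<longleftrightarrow> l \<noteq> m \<and> admissible_move\<^sup>*\<^sup>* m l"

definition partition_ge :: "nat multiset \<Rightarrow> nat multiset \<Rightarrow> bool" where
  "partition_ge l m \<longleftrightarrow> partition_gt l m \<or> l = m"

definition Building_Partitions :: "nat \<Rightarrow> nat multiset set" where
  "Building_Partitions n = {l \<in> Partitions n. l = {#n#} \<or> size {#k \<in># l. k \<ge> 2#} \<ge> 2}"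

definition Antichains :: "nat \<Rightarrow> nat multiset set set" where
  "Antichains n = {S. S \<noteq> {} \<and> S \<subseteq> Building_Partitions n \<and>
     pairwise (\<lambda>l m. \<not> partition_ge l m \<and> \<not> partition_ge m l) S}"

subsection \<open>The sets \<open>\<G>\<^sub>\<lambda>\<close> and \<open>\<G>\<^sub>S\<close>\<close>

definition G_tilde :: "nat multiset \<Rightarrow> 'n::finite functional set set" where
  "G_tilde l = {U \<in> C_A. \<exists>g \<in> Partitions CARD('n). partition_ge g l \<and> has_form U g}"

definition G_partition :: "nat multiset \<Rightarrow> 'n::finite functional set set" where
  "G_partition l = F_A \<union> G_tilde l"

definition G_antichain :: "nat multiset set \<Rightarrow> 'n::finite functional set set" where
  "G_antichain S = (\<Union>l\<in>S. G_partition l)"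

end

theory Submission
  imports Defs
begin

text \<open>
A subspace in \<open>C_A\<close> is the span of the differences \<open>x\<^sub>a - x\<^sub>b\<close> with \<open>a\<close>, \<open>b\<close> in a common block of a
unique set partition, and its form is the multiset of block sizes. Two subspaces with the same form
are conjugate under the symmetric group, so an invariant family of subspaces is the same thing as a
set of forms. Call a block nontrivial if it has more than one element.

Three facts carry the proof.

The order on forms is a relation between set partitions. If \<open>Q\<close> is coarser than \<open>P\<close> and no nontrivial
block of \<open>Q\<close> is smaller than the smallest nontrivial block of \<open>P\<close>, then the form of \<open>Q\<close> is \<open>\<ge>\<close> the
form of \<open>P\<close>: one first creates, by moves (b), the blocks of \<open>Q\<close> that consist of singletons of \<open>P\<close>,
while the smallest block of \<open>P\<close> is still present, and then reaches \<open>Q\<close> by moves (a)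
(\<open>moves_if_refines\<close>). Conversely every form \<open>\<ge>\<close> that of \<open>P\<close> is the form of such a \<open>Q\<close>
(\<open>refinement_of_moves\<close>).

A family \<open>G\<close> with \<open>F_A \<subseteq> G \<subseteq> C_A\<close> is building if and only if \<open>U + W \<in> G\<close> whenever \<open>U\<close>, \<open>W\<close> in \<open>G\<close>
share a root \<open>x\<^sub>a - x\<^sub>b\<close> (\<open>building_joins\<close>, \<open>building_if_joins\<close>). In this form the building property of
\<open>G_antichain S\<close> follows from the first fact: the form of the sum of two members
of sets \<open>G_tilde\<close> is \<open>\<ge>\<close> the form of the summand with the smaller smallest nontrivial block, and adding
an irreducible subspace that shares a root with the other summand only merges its block into a
nontrivial block of that summand (\<open>building_G_antichain\<close>).

If an invariant building set \<open>G \<supseteq> F_A\<close> contains the subspace of a partition \<open>P\<close> with at least two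
nontrivial blocks, then it contains all subspaces whose form is \<open>\<ge>\<close> that of \<open>P\<close>
(\<open>invariant_building_upward_closed\<close>). The crucial case is the creation of a block \<open>D\<close> of singletons
with \<open>card D \<ge> card Y\<close>, where \<open>Y\<close> is a smallest nontrivial block: exchange \<open>Y\<close> with a subset of
\<open>D\<close> by a permutation. The conjugate subspace shares with the original one the roots of a second
nontrivial block, so their sum lies in \<open>G\<close>; it contains roots of \<open>D\<close>, so the irreducible of \<open>D\<close> may be
added as well. This is where two nontrivial blocks are required, and why building partitions have at
least two large parts.

Hence an invariant building set is determined by the minimal elements among the building partitions
that occur in it, which gives surjectivity. For injectivity, the forms in \<open>S\<close> are the minimal building
partitions that occur in \<open>G_antichain S\<close>.
\<close>

section \<open>Set partitions and their block sizes\<close>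

text \<open>
For a partition \<open>P\<close> of the index set this is the form of \<open>partition_subspace P\<close>
(lemma \<open>has_form_iff\<close>).
\<close>

definition block_sizes :: "'a set set \<Rightarrow> nat multiset" where
  "block_sizes P = image_mset card (mset_set P)"

definition merge :: "'a set set \<Rightarrow> 'a set set \<Rightarrow> 'a set set" where
  "merge P S = insert (\<Union>S) (P - S)"

lemma partition_block_unique:
  assumes "partition_on A P" "X \<in> P" "Y \<in> P" "x \<in> X" "x \<in> Y"
  shows "X = Y"
  using assms unfolding partition_on_def disjoint_def by blast

lemma partition_block_cover:
  assumes "partition_on A P" "x \<in> A"
  obtains X where "X \<in> P" "x \<in> X"
  using assms unfolding partition_on_def by blast

lemma partition_blocks_finite:
  assumes "finite A" "partition_on A P" "X \<in> P"
  shows "finite X" "X \<noteq> {}" "X \<subseteq> A"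
  using assms unfolding partition_on_def by (auto intro: finite_subset)

lemma singleton_block_iff:
  assumes "finite A" "partition_on A P" "X \<in> P"
  shows "\<not> 1 < card X \<longleftrightarrow> (\<exists>x. X = {x})"
proof -
  have "card X > 0"
    using partition_blocks_finite[OF assms] by (simp add: card_gt_0_iff)
  then show ?thesis
    by (metis One_nat_def card_1_singletonE is_singletonI is_singleton_altdef less_irrefl linorder_neqE_nat
        less_one not_less_eq)
qed

lemma refinesD:
  assumes "refines A P Q" "X \<in> P" "Y \<in> Q" "x \<in> X" "x \<in> Y"
  shows "X \<subseteq> Y"
proof -
  obtain Z where "Z \<in> Q" "X \<subseteq> Z"
    using assms unfolding refines_def by blast
  with assms partition_block_unique[of A Q Y Z x] show ?thesis
    unfolding refines_def by blast
qed

lemma refines_subset_eq: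
  assumes "refines A P Q" "Q \<subseteq> P"
  shows "P = Q"
proof (rule refines_asym[OF assms(1)])
  show "refines A Q P"
    using assms unfolding refines_def by blast
qed

lemma merge_partition_on:
  assumes P: "partition_on A P" and S: "S \<subseteq> P" "S \<noteq> {}"
  shows "partition_on A (merge P S)"
proof (rule partition_onI)
  show "\<Union> (merge P S) = A"
    using P S unfolding merge_def partition_on_def by blast
  have "{} \<notin> P"
    using P by (rule partition_onD3)
  moreover from this have "\<Union>S \<noteq> {}"
    using S by (metis Sup_upper all_not_in_conv subset_empty subsetD)
  ultimately show "{} \<notin> merge P S"
    by (simp add: merge_def)
  fix p q assume pq: "p \<in> merge P S" "q \<in> merge P S" "p \<noteq> q"
  have "x \<notin> q" if "x \<in> p" for x
  proof
    assume "x \<in> q"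
    with pq that S partition_block_unique[OF P] show False
      unfolding merge_def by (elim insertE) (simp, blast+)
  qed
  then show "disjnt p q"
    by (auto simp: disjnt_iff)
qed

lemma refines_merge:
  assumes "partition_on A P" "S \<subseteq> P" "S \<noteq> {}"
  shows "refines A P (merge P S)"
  using assms merge_partition_on[OF assms] unfolding refines_def merge_def by blast

lemma merge_refines:
  assumes "refines A P Q" "S \<subseteq> P" "S \<noteq> {}" "D \<in> Q" "\<Union>S \<subseteq> D"
  shows "refines A (merge P S) Q"
proof -
  have "partition_on A (merge P S)"
    using assms unfolding refines_def by (intro merge_partition_on) auto
  with assms show ?thesis
    unfolding refines_def merge_def by blast
qed

lemma block_sizes_split:
  assumes "finite P" "S \<subseteq> P"
  shows "block_sizes P = block_sizes (P - S) + block_sizes S"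
proof -
  have "mset_set ((P - S) \<union> S) = mset_set (P - S) + mset_set S"
    using assms finite_subset[OF assms(2)] by (intro mset_set_Union) auto
  moreover have "(P - S) \<union> S = P"
    using assms(2) by blast
  ultimately show ?thesis
    by (simp add: block_sizes_def)
qed

lemma sum_block_sizes:
  assumes "finite A" "partition_on A P" "S \<subseteq> P"
  shows "sum_mset (block_sizes S) = card (\<Union>S)"
proof -
  have "disjoint S"
    using assms(2,3) unfolding partition_on_def by (meson pairwise_subset)
  then have "card (\<Union>S) = sum card S"
    using assms(3) partition_blocks_finite(1)[OF assms(1,2)]
    by (intro card_Union_disjoint) blast+
  then show ?thesis
    by (simp add: block_sizes_def sum_unfold_sum_mset)
qed

lemma block_sizes_merge:
  assumes "finite A" "partition_on A P" "S \<subseteq> P" "S \<noteq> {}"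
  shows "block_sizes (merge P S) = block_sizes (P - S) + {#sum_mset (block_sizes S)#}"
proof -
  have "\<Union>S \<notin> P - S"
    using assms partition_block_unique[OF assms(2)] partition_blocks_finite(2)[OF assms(1,2)] by blast
  moreover have "finite P"
    using assms finite_elements by blast
  ultimately show ?thesis
    unfolding sum_block_sizes[OF assms(1-3)] by (simp add: merge_def block_sizes_def)
qed

lemma card_merge:
  assumes "finite P" "S \<subseteq> P" "X \<in> S" "Y \<in> S" "X \<noteq> Y"
  shows "card (merge P S) < card P"
proof -
  have "card {X, Y} \<le> card S"
    using assms finite_subset[OF assms(2)] by (intro card_mono) auto
  then have "2 \<le> card S"
    using assms by simp
  moreover have "card (P - S) = card P - card S" "card S \<le> card P"
    using assms finite_subset[of S P] by (auto simp: card_Diff_subset card_mono)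
  moreover have "card (merge P S) \<le> Suc (card (P - S))"
    unfolding merge_def by (rule card_insert_le_m1) (use assms in auto)
  ultimately show ?thesis by linarith
qed

lemma block_sizes_singletons:
  "finite D \<Longrightarrow> block_sizes ((\<lambda>x. {x}) ` D) = replicate_mset (card D) 1"
  by (simp add: block_sizes_def image_mset_mset_set[symmetric] multiset.map_comp o_def image_mset_const_eq)

lemma in_block_sizes:
  "finite P \<Longrightarrow> r \<in># block_sizes P \<longleftrightarrow> (\<exists>X\<in>P. r = card X)"
  by (auto simp: block_sizes_def)

section \<open>The order on forms as coarsening of set partitions\<close>

text \<open>
Moves (a) suffice here: a nontrivial block of \<open>Q\<close> can be assembled by letting the nontrivial block of
\<open>P\<close> inside it absorb the other blocks one at a time, and an absorbing block stays nontrivial.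
\<close>

lemma moves_if_blocks_inherited:
  assumes "finite A" "refines A P Q"
    and "\<forall>D\<in>Q. 1 < card D \<longrightarrow> (\<exists>Y\<in>P. Y \<subseteq> D \<and> 1 < card Y)"
  shows "admissible_move\<^sup>*\<^sup>* (block_sizes P) (block_sizes Q)"
  using assms(2,3)
proof (induction "card P" arbitrary: P rule: less_induct)
  case less
  note P = less.prems(1)
  have PA: "partition_on A P" and QA: "partition_on A Q"
    using P unfolding refines_def by auto
  have fP: "finite P"
    using PA assms(1) finite_elements by blast
  show ?case
  proof (cases "Q \<subseteq> P")
    case True
    then show ?thesis
      using refines_subset_eq[OF P] by simp
  next
    case False
    then obtain D where D: "D \<in> Q" "D \<notin> P" by blast
    have "1 < card D"
    proof (rule ccontr)
      assume "\<not> 1 < card D"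
      then obtain x where x: "D = {x}"
        using singleton_block_iff[OF assms(1) QA D(1)] by blast
      then obtain X where "X \<in> P" "x \<in> X"
        using partition_block_cover[OF PA] QA D by (metis partition_onD1 UnionI insertI1)
      then have "X = D"
        using refinesD[OF P \<open>X \<in> P\<close> D(1)] x by auto
      then show False using \<open>X \<in> P\<close> D by simp
    qed
    then obtain Y where Y: "Y \<in> P" "Y \<subseteq> D" "1 < card Y"
      using less.prems(2) D by blast
    then obtain x where x: "x \<in> D" "x \<notin> Y"
      using D by (metis subsetI subset_antisym)
    then obtain X where X: "X \<in> P" "x \<in> X"
      using partition_block_cover[OF PA] QA D by (metis partition_onD1 UnionI)
    have XD: "X \<subseteq> D"
      using refinesD[OF P X(1) D(1)] X x by blast
    have XY: "X \<noteq> Y"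
      using X x by blast
    let ?S = "{X, Y}"
    have bS: "block_sizes ?S = {#card X, card Y#}"
      using XY by (simp add: block_sizes_def)
    have S: "?S \<subseteq> P" "?S \<noteq> {}"
      using X Y by auto
    have "admissible_move (block_sizes P) (block_sizes (merge P ?S))"
      unfolding block_sizes_merge[OF assms(1) PA S] block_sizes_split[OF fP S(1)] bS
      using admissible_move.join_rows[of "card Y" "block_sizes (P - ?S)" "card X"] Y(3) by simp
    moreover have "admissible_move\<^sup>*\<^sup>* (block_sizes (merge P ?S)) (block_sizes Q)"
    proof (rule less.hyps)
      show "card (merge P ?S) < card P"
        using card_merge[OF fP S(1)] XY by blast
      show "refines A (merge P ?S) Q"
        using XD Y D by (intro merge_refines[OF P S]) auto
      show "\<forall>E\<in>Q. 1 < card E \<longrightarrow> (\<exists>Z\<in>merge P ?S. Z \<subseteq> E \<and> 1 < card Z)"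
      proof (intro ballI impI)
        fix E assume E: "E \<in> Q" "1 < card E"
        then obtain Z where Z: "Z \<in> P" "Z \<subseteq> E" "1 < card Z"
          using less.prems(2) by blast
        show "\<exists>Z\<in>merge P ?S. Z \<subseteq> E \<and> 1 < card Z"
        proof (cases "Z \<in> ?S")
          case False
          then show ?thesis using Z by (auto simp: merge_def)
        next
          case True
          then have "Z \<subseteq> D" "Z \<noteq> {}"
            using XD Y Z by auto
          then have "E = D"
            using partition_block_unique[OF QA E(1) D(1)] Z by blast
          moreover have "card Y \<le> card (X \<union> Y)"
            using partition_blocks_finite(1)[OF assms(1) PA] X Y by (intro card_mono) auto
          ultimately show ?thesis
            using XD Y by (intro bexI[of _ "X \<union> Y"]) (auto simp: merge_def)
        qed
      qed
    qed
    ultimately show ?thesis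
      by (rule converse_rtranclp_into_rtranclp)
  qed
qed

text \<open>
The order of the moves matters. Blocks of \<open>Q\<close> made of singletons of \<open>P\<close> have to be created before any
merging, because \<open>Y\<close>, which witnesses that move (b) is admissible, may be absorbed later.
\<close>

lemma moves_if_refines:
  assumes "finite A" "refines A P Q"
    and "Y \<in> P" "1 < card Y" "\<forall>D\<in>Q. 1 < card D \<longrightarrow> card Y \<le> card D"
  shows "admissible_move\<^sup>*\<^sup>* (block_sizes P) (block_sizes Q)"
  using assms(2,3)
proof (induction "card P" arbitrary: P rule: less_induct)
  case less
  note P = less.prems(1)
  have PA: "partition_on A P" and QA: "partition_on A Q"
    using P unfolding refines_def by auto
  have fP: "finite P"
    using PA assms(1) finite_elements by blast
  show ?case
  proof (cases "\<exists>D\<in>Q. 1 < card D \<and> (\<forall>x\<in>D. {x} \<in> P)")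
    case True
    then obtain D where D: "D \<in> Q" "1 < card D" "\<forall>x\<in>D. {x} \<in> P" by blast
    \<comment> \<open>Move (b) on the singletons in \<open>D\<close>; \<open>Y\<close> is not among them and survives the move.\<close>
    let ?S = "(\<lambda>x. {x}) ` D"
    have fD: "finite D"
      using D(2) by (metis card.infinite not_less_zero)
    have S: "?S \<subseteq> P" "?S \<noteq> {}"
      using D by auto
    have YS: "Y \<notin> ?S"
      using assms(4) by auto
    have bP: "block_sizes P = block_sizes (P - ?S) + replicate_mset (card D) 1"
      using block_sizes_split[OF fP S(1)] block_sizes_singletons[OF fD] by simp
    have "admissible_move (block_sizes P) (block_sizes (P - ?S) + {#card D#})"
    proof (rule admissible_move.join_boxes)
      show "\<exists>r\<in>#block_sizes P. 1 < r"
        using assms(4) less.prems(2) in_block_sizes[OF fP] by blast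
      have "card Y \<in> {r. r \<in># block_sizes P \<and> 1 < r}"
        using less.prems(2) assms(4) in_block_sizes[OF fP] by blast
      then have "Min {r. r \<in># block_sizes P \<and> 1 < r} \<le> card Y"
        by (intro Min_le) simp_all
      also have "\<dots> \<le> card D"
        using D assms(5) by blast
      finally show "Min {r. r \<in># block_sizes P \<and> 1 < r} \<le> card D" .
    qed (use D bP in auto)
    then have "admissible_move (block_sizes P) (block_sizes (merge P ?S))"
      unfolding block_sizes_merge[OF assms(1) PA S] block_sizes_singletons[OF fD] by simp
    moreover have "admissible_move\<^sup>*\<^sup>* (block_sizes (merge P ?S)) (block_sizes Q)"
    proof (rule less.hyps)
      obtain a b where "a \<in> D" "b \<in> D" "a \<noteq> b"
        using D(2) card_le_Suc0_iff_eq[OF fD] by force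
      then show "card (merge P ?S) < card P"
        by (intro card_merge[OF fP S(1), of "{a}" "{b}"]) auto
      show "refines A (merge P ?S) Q"
        using D by (intro merge_refines[OF P S]) auto
      show "Y \<in> merge P ?S"
        using YS less.prems(2) by (simp add: merge_def)
    qed
    ultimately show ?thesis
      by (rule converse_rtranclp_into_rtranclp)
  next
    case False
    have "\<exists>Y\<in>P. Y \<subseteq> D \<and> 1 < card Y" if D: "D \<in> Q" "1 < card D" for D
    proof -
      obtain x where x: "x \<in> D" "{x} \<notin> P"
        using False D by blast
      then obtain X where X: "X \<in> P" "x \<in> X"
        using partition_block_cover[OF PA] QA D by (metis partition_onD1 UnionI)
      then have "1 < card X"
        using singleton_block_iff[OF assms(1) PA X(1)] x by auto
      then show ?thesis
        using refinesD[OF P X(1) D(1)] X x by blast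
    qed
    then show ?thesis
      using moves_if_blocks_inherited[OF assms(1) P] by blast
  qed
qed

text \<open>
Lifts the rows that a move acts on to actual blocks of a set partition.
\<close>

lemma subfamily_with_block_sizes:
  assumes "finite P" "block_sizes P = N + K"
  obtains S where "S \<subseteq> P" "block_sizes S = K" "block_sizes (P - S) = N"
proof -
  obtain B C where BC: "mset_set P = B + C" "N = image_mset card B" "K = image_mset card C"
    using assms image_mset_eq_plusD[of card "mset_set P" N K] unfolding block_sizes_def by auto
  have "C \<subseteq># mset_set P"
    using BC by simp
  moreover have "set_mset C \<subseteq> P"
    using BC assms(1) by (metis elem_mset_set mset_subset_eqD calculation subsetI)
  moreover have "C = mset_set (set_mset C)"
  proof (rule subset_mset.antisym[OF mset_subset_eqI mset_set_set_mset_msubset])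
    fix x
    have "count C x \<le> count (mset_set P) x"
      using calculation(1) by (simp add: mset_subset_eq_count)
    also have "\<dots> \<le> 1"
      by (simp add: count_mset_set')
    finally show "count C x \<le> count (mset_set (set_mset C)) x"
      by (cases "x \<in># C") (simp_all add: not_in_iff)
  qed
  ultimately have S: "set_mset C \<subseteq> P" "block_sizes (set_mset C) = K"
    using BC by (auto simp: block_sizes_def)
  moreover have "block_sizes (P - set_mset C) = N"
    using block_sizes_split[OF assms(1) S(1)] S(2) assms(2) by simp
  ultimately show ?thesis
    using that by blast
qed

text \<open>
Both kinds of move replace a submultiset \<open>K\<close> of the rows by the single row \<open>sum_mset K\<close>, so both lift
to a merge of blocks. A lower bound \<open>m\<close> for the sizes of nontrivial blocks survives: in move (a) one of
the joined rows has at least two boxes, hence at least \<open>m\<close>, and in move (b) the new row is at least as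
long as some old row with more than one box.
\<close>

lemma refinement_of_move:
  assumes "finite A" "partition_on A P" "admissible_move (block_sizes P) l"
    and m: "\<forall>X\<in>P. 1 < card X \<longrightarrow> m \<le> card X"
  shows "\<exists>Q. refines A P Q \<and> block_sizes Q = l \<and> (\<forall>X\<in>Q. 1 < card X \<longrightarrow> m \<le> card X)"
proof -
  have fP: "finite P"
    using assms finite_elements by blast
  have m': "\<forall>r\<in>#block_sizes P. 1 < r \<longrightarrow> m \<le> r"
    using m in_block_sizes[OF fP] by metis
  obtain N K where NK: "block_sizes P = N + K" "l = N + {#sum_mset K#}" "K \<noteq> {#}" "m \<le> sum_mset K"
    using assms(3)
  proof cases
    case (join_rows b N a)
    have "b \<in># block_sizes P"
      using join_rows by simp
    then have "m \<le> b"
      using m' join_rows(3) by simp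
    then show ?thesis
      using that[of N "{#a, b#}"] join_rows by simp
  next
    case (join_boxes k N)
    let ?R = "{r. r \<in># block_sizes P \<and> 1 < r}"
    have "Min ?R \<in> ?R"
      using join_boxes by (intro Min_in) auto
    then have "m \<le> Min ?R"
      using m' by blast
    then show ?thesis
      using that[of N "replicate_mset k 1"] join_boxes by simp
  qed
  obtain S where S: "S \<subseteq> P" "block_sizes S = K" "block_sizes (P - S) = N"
    using subfamily_with_block_sizes[OF fP NK(1)] .
  then have "S \<noteq> {}"
    using NK(3) by (auto simp: block_sizes_def)
  note S' = assms(1,2) S(1) this
  have "block_sizes (merge P S) = l"
    using block_sizes_merge[OF S'] S NK by simp
  moreover have "\<forall>X\<in>merge P S. 1 < card X \<longrightarrow> m \<le> card X"
    using m NK(4) sum_block_sizes[OF S'(1-3)] S(2) by (auto simp: merge_def)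
  ultimately show ?thesis
    using refines_merge[OF S'(2-4)] by blast
qed

lemma refinement_of_moves:
  assumes "finite A" "partition_on A P" "admissible_move\<^sup>*\<^sup>* (block_sizes P) l"
    and m: "\<forall>X\<in>P. 1 < card X \<longrightarrow> m \<le> card X"
  shows "\<exists>Q. refines A P Q \<and> block_sizes Q = l \<and> (\<forall>X\<in>Q. 1 < card X \<longrightarrow> m \<le> card X)"
  using assms(3)
proof (induction rule: rtranclp_induct)
  case base
  then show ?case
    using refines_refl[OF assms(2)] m by blast
next
  case (step k l)
  then obtain Q where Q: "refines A P Q" "block_sizes Q = k" "\<forall>X\<in>Q. 1 < card X \<longrightarrow> m \<le> card X"
    by blast
  then obtain R where "refines A Q R" "block_sizes R = l" "\<forall>X\<in>R. 1 < card X \<longrightarrow> m \<le> card X"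
    using refinement_of_move[OF assms(1), of Q l m] step.hyps(2) unfolding refines_def by blast
  then show ?case
    using refines_trans[OF Q(1)] by blast
qed

text \<open>
Applied to partitions of the index set, this says that subspaces with the same form lie in one orbit
of the symmetric group.
\<close>

lemma same_block_sizes_bij:
  assumes "finite P" "finite A" "finite A'" "partition_on A P" "partition_on A' P'"
    "block_sizes P = block_sizes P'"
  shows "\<exists>f. bij_betw f A A' \<and> (`) f ` P = P'"
  using assms
proof (induction P arbitrary: A A' P' rule: finite_induct)
  case empty
  have "finite P'"
    using empty finite_elements by blast
  then have "P' = {}"
    using empty by (simp add: block_sizes_def mset_set_empty_iff)
  then show ?case
    using empty by (auto simp: partition_on_def bij_betw_def)
next
  case (insert X P)
  have fP': "finite P'"
    using insert.prems finite_elements by blast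
  have bs: "block_sizes P' = block_sizes P + {#card X#}"
    using insert by (simp add: block_sizes_def)
  then have "card X \<in># block_sizes P'"
    by simp
  then obtain X' where X': "X' \<in> P'" "card X = card X'"
    using in_block_sizes[OF fP'] by blast
  have dX: "disjnt X (\<Union>P)" 
    using insert.prems(3) insert.hyps unfolding partition_on_def disjoint_def disjnt_def by fastforce
  have pA: "partition_on (A - X) P" "X \<subseteq> A"
    using insert.prems(3) partition_on_insert[OF dX] by auto
  have dX': "disjnt X' (\<Union>(P' - {X'}))" 
    using insert.prems(4) X' unfolding partition_on_def disjoint_def disjnt_def by fastforce
  have pA': "partition_on (A' - X') (P' - {X'})" "X' \<subseteq> A'"
    using insert.prems(4) partition_on_insert[OF dX'] X' by (auto simp: insert_absorb)
  have "block_sizes P = block_sizes (P' - {X'})"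
    using block_sizes_split[OF fP', of "{X'}"] X' bs by (simp add: block_sizes_def)
  then obtain f where f: "bij_betw f (A - X) (A' - X')" "(`) f ` P = P' - {X'}"
    using insert.IH[OF _ _ pA(1) pA'(1)] insert.prems by blast
  obtain g where g: "bij_betw g X X'"
    using X' pA pA' insert.prems finite_same_card_bij by (metis finite_subset)
  define h where "h = (\<lambda>x. if x \<in> X then g x else f x)"
  have hX: "bij_betw h X X'"
    using g by (simp add: h_def cong: bij_betw_cong)
  have hA: "bij_betw h (A - X) (A' - X')"
    using f(1) by (rule bij_betw_cong[THEN iffD1, rotated]) (auto simp: h_def)
  have "bij_betw h (X \<union> (A - X)) (X' \<union> (A' - X'))"
    using hX hA by (rule bij_betw_combine) auto
  then have "bij_betw h A A'"
    using pA pA' by (simp add: Un_absorb1)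
  moreover have "h ` Y = f ` Y" if "Y \<in> P" for Y
    using that dX by (intro image_cong) (auto simp: disjnt_iff h_def)
  then have "(`) h ` P = P' - {X'}"
    using f(2) by (metis (no_types, lifting) image_cong)
  moreover have "h ` X = X'"
    using hX by (simp add: bij_betw_def)
  ultimately show ?case
    using X'(1) by (metis image_insert insert_Diff)
qed

lemma partition_with_block_sizes:
  assumes "finite A" "\<forall>k\<in>#l. k > 0" "sum_mset l = card A"
  shows "\<exists>P. partition_on A P \<and> block_sizes P = l"
  using assms
proof (induction l arbitrary: A)
  case empty
  then show ?case
    by (auto simp: partition_on_def block_sizes_def)
next
  case (add k l)
  then obtain X where X: "X \<subseteq> A" "card X = k"
    by (metis le_add1 obtain_subset_with_card_n sum_mset.add_mset)
  have "card (A - X) = sum_mset l"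
    using X add.prems finite_subset[of X A] by (simp add: card_Diff_subset)
  then obtain P where P: "partition_on (A - X) P" "block_sizes P = l"
    using add.IH[of "A - X"] add.prems by auto
  have X0: "X \<noteq> {}"
    using X add.prems by auto
  have dX: "disjnt X (\<Union>P)"
    using P by (auto simp: partition_on_def disjnt_def)
  have "X \<notin> P"
    using dX X0 by (auto simp: disjnt_def)
  moreover have "finite P"
    using P add.prems finite_elements by blast
  ultimately have "block_sizes (insert X P) = add_mset k l"
    using P X by (simp add: block_sizes_def)
  then show ?case
    using partition_on_insert[OF dX] P X X0 by blast
qed

lemma block_sizes_Partitions:
  assumes "finite A" "partition_on A P"
  shows "block_sizes P \<in> Partitions (card A)"
proof -
  have "0 < card X" if "X \<in> P" for X
    using partition_blocks_finite[OF assms that] by (simp add: card_gt_0_iff)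
  moreover have "sum_mset (block_sizes P) = card A"
    using sum_block_sizes[OF assms order_refl] assms(2) by (simp add: partition_on_def)
  ultimately show ?thesis
    using in_block_sizes[of P] finite_elements[OF assms] by (auto simp: Partitions_def)
qed

text \<open>
Each move lowers the number of rows; this gives antisymmetry of the order and the existence of minimal
elements.
\<close>

lemma admissible_move_size: "admissible_move m l \<Longrightarrow> size l < size m"
  by (induction rule: admissible_move.induct) auto

lemma admissible_moves_size: "admissible_move\<^sup>*\<^sup>* m l \<Longrightarrow> m = l \<or> size l < size m"
  by (induction rule: rtranclp_induct) (auto dest: admissible_move_size)

lemma partition_ge_iff: "partition_ge l m \<longleftrightarrow> admissible_move\<^sup>*\<^sup>* m l"
  by (auto simp: partition_ge_def partition_gt_def)

lemma partition_ge_antisym: "partition_ge l m \<Longrightarrow> partition_ge m l \<Longrightarrow> l = m"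
  unfolding partition_ge_iff by (metis admissible_moves_size less_asym)

lemma partition_ge_trans: "partition_ge l m \<Longrightarrow> partition_ge m k \<Longrightarrow> partition_ge l k"
  unfolding partition_ge_iff by (rule rtranclp_trans)

section \<open>Subspaces spanned by differences of coordinates\<close>

text \<open>
These functionals are the roots of type \<open>A\<^bsub>n-1\<^esub>\<close>; the names of lemmas refer to them as roots.
\<close>

abbreviation coord_diff :: "'n::finite \<Rightarrow> 'n \<Rightarrow> 'n functional" where
  "coord_diff a b \<equiv> coord a - coord b"

lemma subspace_partition_subspace: "dual.subspace (partition_subspace P)"
  unfolding partition_subspace_def by (rule dual.subspace_span)

lemma root_in_partition_subspace:
  "B \<in> P \<Longrightarrow> a \<in> B \<Longrightarrow> b \<in> B \<Longrightarrow> coord_diff a b \<in> partition_subspace P"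
  unfolding partition_subspace_def by (rule dual.span_base) blast

lemma partition_subspace_least:
  assumes "dual.subspace U" "\<And>B a b. B \<in> P \<Longrightarrow> a \<in> B \<Longrightarrow> b \<in> B \<Longrightarrow> a \<noteq> b \<Longrightarrow> coord_diff a b \<in> U"
  shows "partition_subspace P \<subseteq> U"
proof -
  have "coord_diff a b \<in> U" if "B \<in> P" "a \<in> B" "b \<in> B" for B a b
    using assms(2)[OF that] dual.subspace_0[OF assms(1)] by (cases "a = b") auto
  then show ?thesis
    unfolding partition_subspace_def by (intro dual.span_minimal[OF _ assms(1)]) blast
qed

lemma partition_subspace_mono: "P \<subseteq> Q \<Longrightarrow> partition_subspace P \<subseteq> partition_subspace Q"
  by (rule partition_subspace_least[OF subspace_partition_subspace])
    (auto intro: root_in_partition_subspace)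

lemma span_partition_subspace_Un:
  "dual.span (partition_subspace P \<union> partition_subspace Q) = partition_subspace (P \<union> Q)"
proof
  show "dual.span (partition_subspace P \<union> partition_subspace Q) \<subseteq> partition_subspace (P \<union> Q)"
    by (intro dual.span_minimal[OF _ subspace_partition_subspace] Un_least partition_subspace_mono)
      auto
  have "partition_subspace P \<union> partition_subspace Q \<subseteq> dual.span (partition_subspace P \<union> partition_subspace Q)"
    by (rule dual.span_superset)
  then show "partition_subspace (P \<union> Q) \<subseteq> dual.span (partition_subspace P \<union> partition_subspace Q)"
    by (intro partition_subspace_least[OF dual.subspace_span])
      (use root_in_partition_subspace in blast)
qed

text \<open>
Singletons contribute only the zero functional. In particular the irreducible subspaces are those of
the families \<open>{D}\<close> with \<open>1 < card D\<close>.
\<close>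

lemma partition_subspace_nontrivial_blocks:
  "partition_subspace P = partition_subspace {B \<in> P. 1 < card B}"
proof
  show "partition_subspace P \<subseteq> partition_subspace {B \<in> P. 1 < card B}"
  proof (rule partition_subspace_least[OF subspace_partition_subspace])
    fix B a b assume B: "B \<in> P" "a \<in> B" "b \<in> B" "a \<noteq> b"
    then have "1 < card B"
      by (metis card_le_Suc0_iff_eq finite One_nat_def not_less)
    then show "coord_diff a b \<in> partition_subspace {B \<in> P. 1 < card B}"
      using B by (intro root_in_partition_subspace[of B]) auto
  qed
qed (rule partition_subspace_mono, auto)

text \<open>
Membership in \<open>partition_subspace P\<close> is refuted by evaluating a functional at two vectors that the
generators do not distinguish.
\<close>

lemma partition_subspace_eval_eq:
  assumes "f \<in> partition_subspace P"
    and "\<And>B a b. B \<in> P \<Longrightarrow> a \<in> B \<Longrightarrow> b \<in> B \<Longrightarrow> a \<noteq> b \<Longrightarrow> v $ a - v $ b = w $ a - w $ b"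
  shows "f v = f w"
proof -
  have "dual.subspace {f. f v = f w}"
    by (auto simp: dual.subspace_def dual_scale_def)
  then have "partition_subspace P \<subseteq> {f. f v = f w}"
    by (rule partition_subspace_least) (use assms(2) in \<open>simp add: coord_def\<close>)
  then show ?thesis
    using assms(1) by blast
qed

lemma root_in_partition_subspaceD:
  assumes "coord_diff a b \<in> partition_subspace P" "a \<noteq> b"
  shows "\<exists>B\<in>P. a \<in> B \<and> 1 < card B"
proof (rule ccontr)
  assume "\<not> ?thesis"
  then have no: "c \<noteq> a \<and> d \<noteq> a" if "B \<in> P" "c \<in> B" "d \<in> B" "c \<noteq> d" for B c d
    using that by (metis card_le_Suc0_iff_eq finite One_nat_def not_less)
  have "coord_diff a b (axis a 1) = coord_diff a b 0"
    by (rule partition_subspace_eval_eq[OF assms(1)]) (use no in \<open>auto simp: axis_def\<close>)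
  then show False
    using assms(2) by (simp add: coord_def axis_def)
qed

text \<open>
All generators vanish on the indicator vector of the block of \<open>a\<close>, but \<open>x\<^sub>a - x\<^sub>b\<close> does not if \<open>b\<close> is
outside that block.
\<close>

lemma root_in_partition_subspace_iff:
  assumes "partition_on UNIV P"
  shows "coord_diff a b \<in> partition_subspace P \<longleftrightarrow> (\<exists>B\<in>P. a \<in> B \<and> b \<in> B)"
proof
  assume ab: "coord_diff a b \<in> partition_subspace P"
  obtain B where B: "B \<in> P" "a \<in> B"
    using partition_block_cover[OF assms] by blast
  let ?v = "\<chi> i. if i \<in> B then 1 else 0"
  have "coord_diff a b ?v = coord_diff a b 0"
    by (rule partition_subspace_eval_eq[OF ab])
      (use partition_block_unique[OF assms _ B(1)] in auto)
  then have "b \<in> B"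
    using B by (simp add: coord_def split: if_splits)
  with B show "\<exists>B\<in>P. a \<in> B \<and> b \<in> B"
    by blast
qed (auto intro: root_in_partition_subspace)

lemma partition_subspace_subset_iff:
  assumes "partition_on UNIV P" "partition_on UNIV Q"
  shows "partition_subspace P \<subseteq> partition_subspace Q \<longleftrightarrow> refines UNIV P Q"
proof
  assume sub: "partition_subspace P \<subseteq> partition_subspace Q"
  have "\<exists>Y\<in>Q. X \<subseteq> Y" if X: "X \<in> P" for X
  proof -
    obtain a where a: "a \<in> X"
      using X assms(1) partition_onD3 by fastforce
    obtain Y where Y: "Y \<in> Q" "a \<in> Y"
      using partition_block_cover[OF assms(2)] by blast
    have "b \<in> Y" if "b \<in> X" for b
      using root_in_partition_subspace[OF X a that] sub partition_block_unique[OF assms(2) _ Y(1) _ Y(2)]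
      unfolding root_in_partition_subspace_iff[OF assms(2)]
      by (metis root_in_partition_subspace_iff[OF assms(2)] subsetD)
    with Y show ?thesis by blast
  qed
  with assms show "refines UNIV P Q"
    unfolding refines_def by blast
next
  assume "refines UNIV P Q"
  then show "partition_subspace P \<subseteq> partition_subspace Q"
    unfolding refines_def
    by (intro partition_subspace_least[OF subspace_partition_subspace])
      (meson root_in_partition_subspace subsetD)
qed

lemma partition_subspace_eq_iff:
  assumes "partition_on UNIV P" "partition_on UNIV Q"
  shows "partition_subspace P = partition_subspace Q \<longleftrightarrow> P = Q"
  using partition_subspace_subset_iff[OF assms] partition_subspace_subset_iff[OF assms(2,1)]
    refines_asym by blast

lemma has_form_iff:
  assumes "partition_on UNIV P"
  shows "has_form (partition_subspace P) l \<longleftrightarrow> l = block_sizes P"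
  unfolding has_form_def block_sizes_def using partition_subspace_eq_iff[OF assms] assms by metis

text \<open>
The relation \<open>x\<^sub>a - x\<^sub>b \<in> U\<close> is an equivalence relation because \<open>U\<close> is a subspace.
\<close>

lemma partition_of_roots:
  assumes "dual.subspace U"
  shows "\<exists>P. partition_on UNIV P \<and> (\<forall>a b. coord_diff a b \<in> U \<longleftrightarrow> (\<exists>B\<in>P. a \<in> B \<and> b \<in> B))"
proof -
  let ?r = "{(a, b). coord_diff a b \<in> U}"
  have "equiv UNIV ?r"
  proof (rule equivI)
    show "refl ?r"
      using dual.subspace_0[OF assms] by (auto simp: refl_on_def)
    show "sym ?r"
    proof (rule symI)
      fix a b assume "(a, b) \<in> ?r"
      then show "(b, a) \<in> ?r"
        using dual.subspace_neg[OF assms, of "coord_diff a b"] by simp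
    qed
    show "trans ?r"
    proof (rule transI)
      fix a b c assume "(a, b) \<in> ?r" "(b, c) \<in> ?r"
      then show "(a, c) \<in> ?r"
        using dual.subspace_add[OF assms, of "coord_diff a b" "coord_diff b c"] by simp
    qed
  qed auto
  moreover from this have "coord_diff a b \<in> U \<longleftrightarrow> (\<exists>B\<in>UNIV // ?r. a \<in> B \<and> b \<in> B)" for a b
    using quotient_eq_iff[of UNIV ?r] in_quotient_imp_in_rel[of UNIV ?r]
      equiv_class_self[of UNIV ?r a] quotientI[of a UNIV ?r]
    by (metis (no_types, lifting) Image_singleton_iff UNIV_I case_prodD case_prodI
        empty_subsetI insert_subset mem_Collect_eq)
  ultimately show ?thesis
    using partition_on_quotient by blast
qed

text \<open>
For \<open>P = P\<^sub>1 \<union> P\<^sub>2\<close> with partitions \<open>P\<^sub>1\<close>, \<open>P\<^sub>2\<close> this provides their join, the partition whose subspace is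
the sum of the two subspaces.
\<close>

lemma partition_of_family:
  obtains R where "partition_on UNIV R" "partition_subspace R = partition_subspace P"
proof -
  obtain R where R: "partition_on UNIV R"
    "\<And>a b. coord_diff a b \<in> partition_subspace P \<longleftrightarrow> (\<exists>B\<in>R. a \<in> B \<and> b \<in> B)"
    using partition_of_roots[OF subspace_partition_subspace[of P]] by blast
  have "partition_subspace R \<subseteq> partition_subspace P"
    by (rule partition_subspace_least[OF subspace_partition_subspace]) (use R(2) in blast)
  moreover have "partition_subspace P \<subseteq> partition_subspace R"
  proof (rule partition_subspace_least[OF subspace_partition_subspace])
    fix B a b assume "B \<in> P" "a \<in> B" "b \<in> B"
    then have "coord_diff a b \<in> partition_subspace P"
      by (rule root_in_partition_subspace)
    then obtain D where "D \<in> R" "a \<in> D" "b \<in> D"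
      using R(2) by metis
    then show "coord_diff a b \<in> partition_subspace R"
      by (rule root_in_partition_subspace)
  qed
  ultimately show ?thesis
    using that[OF R(1)] by blast
qed

lemma refines_partition_of_family:
  assumes "partition_on UNIV R" "partition_subspace R = partition_subspace P" "B \<in> P" "B \<noteq> {}"
  obtains D where "D \<in> R" "B \<subseteq> D"
proof -
  obtain a where a: "a \<in> B"
    using assms(4) by blast
  obtain D where D: "D \<in> R" "a \<in> D"
    using partition_block_cover[OF assms(1)] by blast
  have "b \<in> D" if "b \<in> B" for b
    using root_in_partition_subspace[OF assms(3) a that] assms(2) D
      root_in_partition_subspace_iff[OF assms(1)] partition_block_unique[OF assms(1)] by metis
  then show ?thesis
    using that[OF D(1)] by blast
qed

text \<open>
Together with \<open>refines_partition_of_family\<close>, this bounds the blocks of a join from below by the blocks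
that were joined.
\<close>

lemma nontrivial_block_from_family:
  assumes R: "partition_on UNIV R" "partition_subspace R = partition_subspace P"
    and D: "D \<in> R" "1 < card D"
  obtains B where "B \<in> P" "1 < card B" "B \<subseteq> D"
proof -
  obtain a b where ab: "a \<in> D" "b \<in> D" "a \<noteq> b"
    using D(2) card_le_Suc0_iff_eq[of D] by force
  then have "coord_diff a b \<in> partition_subspace P"
    using root_in_partition_subspace[OF D(1)] R(2) by metis
  then obtain B where B: "B \<in> P" "a \<in> B" "1 < card B"
    using root_in_partition_subspaceD ab by blast
  moreover obtain E where E: "E \<in> R" "B \<subseteq> E"
    using refines_partition_of_family[OF R B(1)] B(2) by blast
  then have "E = D"
    using partition_block_unique[OF R(1) E(1) D(1)] B ab by blast
  ultimately show ?thesis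
    using that E by blast
qed

lemma partition_subspace_nonzero_iff:
  "partition_subspace P \<noteq> {0} \<longleftrightarrow> (\<exists>B\<in>P. 1 < card B)"
proof
  assume "\<exists>B\<in>P. 1 < card B"
  then obtain B where B: "B \<in> P" "1 < card B" by blast
  then obtain a b where ab: "a \<in> B" "b \<in> B" "a \<noteq> b"
    using card_le_Suc0_iff_eq[of B] by force
  have "coord_diff a b (axis a 1) \<noteq> 0"
    using ab by (simp add: coord_def axis_def)
  then have "coord_diff a b \<noteq> 0"
    by (metis zero_fun_apply)
  then show "partition_subspace P \<noteq> {0}"
    using root_in_partition_subspace[OF B(1) ab(1,2)] by blast
next
  assume nz: "partition_subspace P \<noteq> {0}"
  show "\<exists>B\<in>P. 1 < card B"
  proof (rule ccontr)
    assume "\<not> ?thesis"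
    then have empty: "{B \<in> P. 1 < card B} = {}"
      by blast
    have "partition_subspace P = partition_subspace {}"
      using partition_subspace_nontrivial_blocks[of P] unfolding empty .
    also have "\<dots> = {0}"
      by (simp add: partition_subspace_def)
    finally show False
      using nz by contradiction
  qed
qed

lemma linear_functional_iff:
  "f \<in> dual_space \<longleftrightarrow> (\<forall>u v. f (u + v) = f u + f v) \<and> (\<forall>c v. f (c *s v) = c * f v)"
proof -
  have "vector_space ((*) :: complex \<Rightarrow> complex \<Rightarrow> complex)"
    by unfold_locales (auto simp: algebra_simps)
  then show ?thesis
    unfolding dual_space_def
    by (auto simp: Vector_Spaces.linear_def module_hom_def module_hom_axioms_def vector_space_def module_def
        vec.vector_space_axioms vector_space_def algebra_simps)
qed

lemma subspace_dual_space: "dual.subspace dual_space"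
  by (auto simp: dual.subspace_def linear_functional_iff dual_scale_def algebra_simps)

lemma partition_subspace_subset_dual: "partition_subspace P \<subseteq> dual_space"
  by (rule partition_subspace_least[OF subspace_dual_space])
    (simp add: linear_functional_iff coord_def algebra_simps)

lemma sum_of_eq_span:
  assumes "finite M" "\<forall>U\<in>M. dual.subspace U"
  shows "sum_of M = dual.span (\<Union>M)"
proof
  show "sum_of M \<subseteq> dual.span (\<Union>M)"
  proof
    fix f assume "f \<in> sum_of M"
    then obtain u where u: "f = (\<Sum>U\<in>M. u U)" "u \<in> (\<Pi>\<^sub>E U\<in>M. U)"
      unfolding sum_of_def by blast
    have "u U \<in> dual.span (\<Union>M)" if "U \<in> M" for U
      using u(2) that by (intro dual.span_base) auto
    then show "f \<in> dual.span (\<Union>M)"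
      unfolding u(1) by (rule dual.span_sum)
  qed
  have "dual.subspace (sum_of M)"
    unfolding dual.subspace_def
  proof (intro conjI ballI allI)
    show "0 \<in> sum_of M"
      unfolding sum_of_def using assms
      by (intro image_eqI[of _ _ "\<lambda>U\<in>M. 0"]) (auto simp: dual.subspace_0)
  next
    fix x y assume "x \<in> sum_of M" "y \<in> sum_of M"
    then obtain u v where u: "x = (\<Sum>U\<in>M. u U)" "u \<in> (\<Pi>\<^sub>E U\<in>M. U)"
      and v: "y = (\<Sum>U\<in>M. v U)" "v \<in> (\<Pi>\<^sub>E U\<in>M. U)"
      unfolding sum_of_def by blast
    then show "x + y \<in> sum_of M"
      unfolding sum_of_def using assms
      by (intro image_eqI[of _ _ "\<lambda>U\<in>M. u U + v U"]) (auto simp: sum.distrib intro!: dual.subspace_add dest: PiE_mem)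
  next
    fix c x assume "x \<in> sum_of M"
    then obtain u where u: "x = (\<Sum>U\<in>M. u U)" "u \<in> (\<Pi>\<^sub>E U\<in>M. U)"
      unfolding sum_of_def by blast
    then show "dual_scale c x \<in> sum_of M"
      unfolding sum_of_def using assms
      by (intro image_eqI[of _ _ "\<lambda>U\<in>M. dual_scale c (u U)"])
        (auto simp: dual.scale_sum_right intro!: dual.subspace_scale dest: PiE_mem)
  qed
  moreover have "\<Union>M \<subseteq> sum_of M"
  proof
    fix f assume "f \<in> \<Union>M"
    then obtain U where U: "U \<in> M" "f \<in> U" by blast
    let ?u = "\<lambda>W\<in>M. if W = U then f else 0"
    have "(\<Sum>W\<in>M. ?u W) = (\<Sum>W\<in>M. if W = U then f else 0)"
      by (rule sum.cong) auto
    also have "\<dots> = f"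
      using U assms(1) by simp
    finally show "f \<in> sum_of M"
      unfolding sum_of_def using U assms
      by (intro image_eqI[of _ _ ?u]) (auto simp: dual.subspace_0)
  qed
  ultimately show "dual.span (\<Union>M) \<subseteq> sum_of M"
    by (rule dual.span_minimal[rotated])
qed

lemma finite_root_lines: "finite (root_lines :: 'n::finite functional set set)"
proof -
  have "root_lines \<subseteq> (\<lambda>(i, j). dual.span {coord_diff i j}) ` (UNIV :: ('n \<times> 'n) set)"
    unfolding root_lines_def by auto
  then show ?thesis
    by (rule finite_subset) simp
qed

lemma finite_C_A: "finite (C_A :: 'n::finite functional set set)"
proof -
  have "C_A \<subseteq> sum_of ` Pow (root_lines :: 'n functional set set)"
    unfolding C_A_def by blast
  then show ?thesis
    by (rule finite_subset) (simp add: finite_root_lines)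
qed

lemma sum_of_root_lines:
  assumes "M \<subseteq> root_lines"
  shows "sum_of M = dual.span (\<Union>M)"
proof (rule sum_of_eq_span)
  show "finite M"
    using assms finite_root_lines finite_subset by blast
  show "\<forall>U\<in>M. dual.subspace U"
    using assms dual.subspace_span unfolding root_lines_def by blast
qed

lemma partition_subspace_in_C_A:
  assumes "\<exists>B\<in>P. 1 < card B"
  shows "partition_subspace P \<in> C_A"
proof -
  let ?M = "{dual.span {coord_diff a b} |a b. a \<noteq> b \<and> (\<exists>B\<in>P. a \<in> B \<and> b \<in> B)}"
  have "partition_subspace P = dual.span (\<Union>?M)"
  proof
    show "partition_subspace P \<subseteq> dual.span (\<Union>?M)"
    proof (rule partition_subspace_least[OF dual.subspace_span])
      fix B a b assume "B \<in> P" "a \<in> B" "b \<in> B" "a \<noteq> b"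
      then have "dual.span {coord_diff a b} \<in> ?M" by blast
      moreover have "coord_diff a b \<in> dual.span {coord_diff a b}"
        by (rule dual.span_base) simp
      ultimately show "coord_diff a b \<in> dual.span (\<Union>?M)"
        by (intro dual.span_base) (rule UnionI)
    qed
    have "dual.span {coord_diff a b} \<subseteq> partition_subspace P" if "B \<in> P" "a \<in> B" "b \<in> B" for a b B
      using root_in_partition_subspace[OF that]
      by (intro dual.span_minimal[OF _ subspace_partition_subspace]) simp
    then show "dual.span (\<Union>?M) \<subseteq> partition_subspace P"
      by (intro dual.span_minimal[OF _ subspace_partition_subspace]) blast
  qed
  moreover have M: "?M \<subseteq> root_lines"
    unfolding root_lines_def by blast
  ultimately have "partition_subspace P = sum_of ?M"
    using sum_of_root_lines[OF M] by metis
  moreover have "partition_subspace P \<noteq> {0}"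
    using assms by (simp only: partition_subspace_nonzero_iff)
  ultimately show ?thesis
    unfolding C_A_def using M by (intro CollectI conjI exI[of _ ?M])
qed

text \<open>
A sum of root lines contains, with its generators, all differences \<open>x\<^sub>a - x\<^sub>b\<close> along the equivalence
relation that they generate.
\<close>

lemma C_A_cases:
  assumes "U \<in> C_A"
  obtains P where "partition_on UNIV P" "\<exists>B\<in>P. 1 < card B" "U = partition_subspace P"
proof -
  obtain M where M: "M \<subseteq> root_lines" "U = sum_of M" and U: "U \<noteq> {0}"
    using assms unfolding C_A_def by blast
  have Uspan: "U = dual.span (\<Union>M)"
    using M sum_of_root_lines by blast
  have sU: "dual.subspace U"
    unfolding Uspan by (rule dual.subspace_span)
  obtain P where P: "partition_on UNIV P" "\<And>a b. coord_diff a b \<in> U \<longleftrightarrow> (\<exists>B\<in>P. a \<in> B \<and> b \<in> B)"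
    using partition_of_roots[OF sU] by blast
  have PU: "partition_subspace P \<subseteq> U"
    by (rule partition_subspace_least[OF sU]) (use P(2) in blast)
  have "W \<subseteq> partition_subspace P" if W: "W \<in> M" for W
  proof -
    obtain i j where ij: "W = dual.span {coord_diff i j}"
      using W M(1) unfolding root_lines_def by blast
    have "coord_diff i j \<in> W"
      unfolding ij by (rule dual.span_base) simp
    then have "coord_diff i j \<in> U"
      unfolding Uspan using W by (intro dual.span_base) blast
    then have "coord_diff i j \<in> partition_subspace P"
      using P(2) root_in_partition_subspace by blast
    then show ?thesis
      unfolding ij by (intro dual.span_minimal[OF _ subspace_partition_subspace]) simp
  qed
  then have "U \<subseteq> partition_subspace P"
    unfolding Uspan by (intro dual.span_minimal[OF _ subspace_partition_subspace]) blast
  then have eq: "U = partition_subspace P"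
    using PU by blast
  then have "\<exists>B\<in>P. 1 < card B"
    using U partition_subspace_nonzero_iff by metis
  then show ?thesis
    using that P(1) eq by blast
qed

lemma partition_with_block:
  fixes D :: "'n::finite set"
  assumes "1 < card D"
  obtains P where "partition_on UNIV P" "{B \<in> P. 1 < card B} = {D}"
proof
  let ?P = "insert D ((\<lambda>x. {x}) ` (- D))"
  have "D \<noteq> {}"
    using assms by auto
  then show "partition_on UNIV ?P"
    by (intro partition_onI) (auto simp: disjnt_iff)
  show "{B \<in> ?P. 1 < card B} = {D}"
    using assms by auto
qed

lemma F_A_iff: "U \<in> F_A \<longleftrightarrow> (\<exists>D. 1 < card D \<and> U = partition_subspace {D})"
proof
  assume "U \<in> F_A"
  then obtain P where P: "U = partition_subspace P" "\<exists>!B. B \<in> P \<and> card B > 1"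
    unfolding F_A_def by (elim CollectE conjE exE)
  then obtain D where D: "D \<in> P" "1 < card D" "\<forall>B. B \<in> P \<and> card B > 1 \<longrightarrow> B = D"
    by (elim ex1E conjE)
  then have "{B \<in> P. 1 < card B} = {D}"
    by blast
  then show "\<exists>D. 1 < card D \<and> U = partition_subspace {D}"
    using P(1) D(2) partition_subspace_nontrivial_blocks[of P] by auto
next
  assume "\<exists>D. 1 < card D \<and> U = partition_subspace {D}"
  then obtain D where D: "1 < card D" "U = partition_subspace {D}" by blast
  obtain P where P: "partition_on UNIV P" "{B \<in> P. 1 < card B} = {D}"
    using partition_with_block[OF D(1)] .
  have "U = partition_subspace P"
    using D P partition_subspace_nontrivial_blocks[of P] by simp
  moreover have "U \<in> C_A"
    using D by (auto intro: partition_subspace_in_C_A)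
  moreover have "\<exists>!B. B \<in> P \<and> card B > 1"
    using P(2) by (intro ex1I[of _ D]) blast+
  ultimately show "U \<in> F_A"
    unfolding F_A_def using P(1) by (intro CollectI conjI exI[of _ P])
qed

lemma perm_act_partition_subspace:
  "perm_act \<sigma> ` partition_subspace P = partition_subspace ((`) \<sigma> ` P)"
proof
  have coord_diff: "perm_act \<sigma> (coord_diff a b) = coord_diff (\<sigma> a) (\<sigma> b)" for a b
    by (simp add: perm_act_def coord_def fun_eq_iff)
  have lin: "perm_act \<sigma> (f + g) = perm_act \<sigma> f + perm_act \<sigma> g" "perm_act \<sigma> 0 = 0"
    "perm_act \<sigma> (dual_scale c f) = dual_scale c (perm_act \<sigma> f)" for f g c
    by (auto simp: perm_act_def dual_scale_def fun_eq_iff)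
  have "dual.subspace {f. perm_act \<sigma> f \<in> partition_subspace ((`) \<sigma> ` P)}"
    using subspace_partition_subspace[of "(`) \<sigma> ` P"] unfolding dual.subspace_def by (simp add: lin)
  then have "partition_subspace P \<subseteq> {f. perm_act \<sigma> f \<in> partition_subspace ((`) \<sigma> ` P)}"
    by (rule partition_subspace_least) (auto simp: coord_diff intro!: root_in_partition_subspace)
  then show "perm_act \<sigma> ` partition_subspace P \<subseteq> partition_subspace ((`) \<sigma> ` P)"
    by blast
  have "dual.subspace (perm_act \<sigma> ` partition_subspace P)"
    unfolding dual.subspace_def
  proof (intro conjI ballI allI)
    note W = subspace_partition_subspace[of P]
    show "0 \<in> perm_act \<sigma> ` partition_subspace P"
      using lin(2) dual.subspace_0[OF W] by (metis image_eqI)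
    fix x assume "x \<in> perm_act \<sigma> ` partition_subspace P"
    then obtain f where f: "x = perm_act \<sigma> f" "f \<in> partition_subspace P"
      by blast
    show "dual_scale c x \<in> perm_act \<sigma> ` partition_subspace P" for c
      unfolding f(1) lin(3)[symmetric] by (intro imageI dual.subspace_scale[OF W] f(2))
    fix y assume "y \<in> perm_act \<sigma> ` partition_subspace P"
    then obtain g where g: "y = perm_act \<sigma> g" "g \<in> partition_subspace P"
      by blast
    show "x + y \<in> perm_act \<sigma> ` partition_subspace P"
      unfolding f(1) g(1) lin(1)[symmetric] by (intro imageI dual.subspace_add[OF W] f(2) g(2))
  qed
  then show "partition_subspace ((`) \<sigma> ` P) \<subseteq> perm_act \<sigma> ` partition_subspace P"
    by (rule partition_subspace_least)
      (auto simp: coord_diff[symmetric] intro!: imageI root_in_partition_subspace)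
qed

section \<open>A criterion for building sets\<close>

lemma C_A_partition_subspace:
  assumes "U \<in> C_A"
  shows "\<exists>P. U = partition_subspace P"
  by (rule C_A_cases[OF assms]) blast

lemma sum_functional_apply: "(\<Sum>i\<in>I. f i) x = (\<Sum>i\<in>I. f i x)"
  by (induction I rule: infinite_finite_induct) auto

lemma subset_max_element:
  assumes "finite G" "A \<in> G" "A \<subseteq> C"
  obtains M where "M \<in> max_elements_in G C" "A \<subseteq> M"
proof -
  have "\<exists>M\<in>{B \<in> G. B \<subseteq> C}. A \<le> M \<and> (\<forall>B\<in>{B \<in> G. B \<subseteq> C}. M \<le> B \<longrightarrow> M = B)"
    by (rule finite_has_maximal2) (use assms in auto)
  then obtain M where M: "M \<in> G" "M \<subseteq> C" "A \<subseteq> M"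
    "\<forall>B\<in>{B \<in> G. B \<subseteq> C}. M \<subseteq> B \<longrightarrow> M = B"
    by blast
  then have "M \<in> max_elements_in G C"
    unfolding max_elements_in_def by simp
  then show ?thesis
    using that M(3) by blast
qed

lemma single_summand_in_product:
  fixes f :: "'n::finite functional"
  assumes "finite M" "\<forall>U\<in>M. dual.subspace U" "A \<in> M" "f \<in> A"
  defines "u \<equiv> \<lambda>U\<in>M. if U = A then f else 0"
  shows "u \<in> (\<Pi>\<^sub>E U\<in>M. U)" "(\<Sum>U\<in>M. u U) = f"
proof -
  show "u \<in> (\<Pi>\<^sub>E U\<in>M. U)"
    using assms by (auto simp: dual.subspace_0)
  have "(\<Sum>U\<in>M. u U) = (\<Sum>U\<in>M. if U = A then f else 0)"
    unfolding u_def by (rule sum.cong) auto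
  also have "\<dots> = f"
    using assms by simp
  finally show "(\<Sum>U\<in>M. u U) = f" .
qed

text \<open>
\<open>U\<close> and \<open>W\<close> lie in maximal elements \<open>A\<close> and \<open>B\<close> of \<open>G\<close> below \<open>U + W\<close>. A common nonzero vector has two
representations in the direct sum, one through \<open>A\<close> and one through \<open>B\<close>, unless \<open>A = B\<close>; then \<open>A\<close> is all
of \<open>U + W\<close>.
\<close>

lemma building_span_Un:
  assumes G: "building G" and U: "U \<in> G" and W: "W \<in> G"
    and f: "f \<in> U" "f \<in> W" "f \<noteq> 0"
  shows "dual.span (U \<union> W) \<in> G"
proof -
  let ?C = "dual.span (U \<union> W)"
  let ?M = "max_elements_in G ?C"
  have fG: "finite G" and sG: "\<forall>U\<in>G. dual.subspace U"
    using G unfolding building_def by auto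
  have "sum_of {U, W} = dual.span (\<Union>{U, W})"
    by (rule sum_of_eq_span) (use U W sG in auto)
  then have "sum_of {U, W} = ?C"
    by simp
  then have "?C \<in> sum_closure G"
    using U W unfolding sum_closure_def by blast
  then have dir: "is_direct_sum ?C ?M"
    using G unfolding building_def by blast
  have MG: "?M \<subseteq> G"
    unfolding max_elements_in_def by blast
  then have fM: "finite ?M" and sM: "\<forall>U\<in>?M. dual.subspace U"
    using fG sG finite_subset by blast+
  have sup: "U \<subseteq> ?C" "W \<subseteq> ?C"
    using dual.span_superset[of "U \<union> W"] by auto
  obtain A where A: "A \<in> ?M" "U \<subseteq> A"
    using subset_max_element[OF fG U sup(1)] .
  obtain B where B: "B \<in> ?M" "W \<subseteq> B"
    using subset_max_element[OF fG W sup(2)] .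
  let ?u = "\<lambda>A. \<lambda>X\<in>?M. if X = A then f else 0"
  have fA: "f \<in> A" and fB: "f \<in> B"
    using A B f by auto
  have "inj_on (\<lambda>u. \<Sum>X\<in>?M. u X) (\<Pi>\<^sub>E X\<in>?M. X)"
    using dir unfolding is_direct_sum_def bij_betw_def by blast
  moreover have "(\<Sum>X\<in>?M. ?u A X) = (\<Sum>X\<in>?M. ?u B X)"
    using single_summand_in_product(2)[OF fM sM A(1) fA] single_summand_in_product(2)[OF fM sM B(1) fB]
    by (metis (no_types, lifting))
  ultimately have "?u A = ?u B"
    using single_summand_in_product(1)[OF fM sM A(1) fA] single_summand_in_product(1)[OF fM sM B(1) fB]
    by (rule inj_onD)
  then have "?u A A = ?u B A"
    by (rule fun_cong)
  then have "A = B"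
    using A(1) f(3) by (simp split: if_splits)
  then have "?C \<subseteq> A"
    using A B sM by (intro dual.span_minimal) auto
  moreover have "A \<subseteq> ?C"
    using A(1) unfolding max_elements_in_def by blast
  ultimately have "A = ?C"
    by blast
  then show ?thesis
    using A(1) MG by blast
qed

lemma root_nonzero:
  assumes "a \<noteq> b"
  shows "coord_diff a b \<noteq> 0"
proof
  assume "coord_diff a b = 0"
  then have "coord_diff a b (axis a 1) = 0"
    by simp
  then show False
    using assms by (simp add: coord_def axis_def)
qed

lemma partition_subspace_Un_least:
  assumes "dual.subspace C" "partition_subspace P \<subseteq> C" "partition_subspace Q \<subseteq> C"
  shows "partition_subspace (P \<union> Q) \<subseteq> C"
  unfolding span_partition_subspace_Un[symmetric] using assms by (intro dual.span_minimal) auto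

text \<open>
\<open>S U\<close> contains every coordinate that the functionals in \<open>U\<close> depend on. Setting all coordinates outside
\<open>S A\<close> to zero therefore isolates the summand from \<open>A\<close>.
\<close>

lemma disjoint_supports_independent:
  fixes M :: "'n::finite functional set set" and S :: "'n functional set \<Rightarrow> 'n set"
  assumes M: "finite M" "M \<subseteq> C_A"
    and supp: "\<And>U a b. U \<in> M \<Longrightarrow> a \<noteq> b \<Longrightarrow> coord_diff a b \<in> U \<Longrightarrow> a \<in> S U"
    and disj: "\<And>U W. U \<in> M \<Longrightarrow> W \<in> M \<Longrightarrow> U \<noteq> W \<Longrightarrow> S U \<inter> S W = {}"
  shows "inj_on (\<lambda>u. \<Sum>U\<in>M. u U) (\<Pi>\<^sub>E U\<in>M. U)"
proof (rule inj_onI)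
  have local: "f v = f w" if UM: "U \<in> M" and fU: "f \<in> U" and vw: "\<forall>i\<in>S U. v $ i = w $ i" for U f v w
  proof -
    obtain P where P: "U = partition_subspace P"
      using C_A_partition_subspace M(2) UM by blast
    have "v $ a - v $ b = w $ a - w $ b" if B: "B \<in> P" "a \<in> B" "b \<in> B" "a \<noteq> b" for B a b
    proof -
      have "a \<in> S U" "b \<in> S U"
        using B supp[OF UM] root_in_partition_subspace[of B P] unfolding P by metis+
      then show ?thesis
        using vw by simp
    qed
    then show ?thesis
      using partition_subspace_eval_eq fU unfolding P by blast
  qed
  have restr: "(\<Sum>U\<in>M. u U) (\<chi> i. if i \<in> S A then x $ i else 0) = u A x"
    if u: "u \<in> (\<Pi>\<^sub>E U\<in>M. U)" and A: "A \<in> M" for u A x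
  proof -
    let ?x = "\<chi> i. if i \<in> S A then x $ i else 0"
    have "u U ?x = (if U = A then u A x else 0)" if U: "U \<in> M" for U
    proof (cases "U = A")
      case True
      have "u A \<in> A"
        using u A by (rule PiE_mem)
      then show ?thesis
        using True local[OF A, of "u A" ?x x] by simp
    next
      case False
      have uU: "u U \<in> U"
        using u U by (rule PiE_mem)
      have "S U \<inter> S A = {}"
        using disj[OF U A False] .
      then have "u U ?x = u U 0"
        by (intro local[OF U uU]) auto
      moreover obtain P where "U = partition_subspace P"
        using C_A_partition_subspace M(2) U by blast
      then have "u U \<in> dual_space"
        using uU partition_subspace_subset_dual by blast
      then have "u U (0 *s 0) = 0 * u U 0"
        unfolding linear_functional_iff by blast
      then have "u U 0 = 0"
        by simp
      ultimately show ?thesis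
        using False by simp
    qed
    then have "(\<Sum>U\<in>M. u U ?x) = (\<Sum>U\<in>M. if U = A then u A x else 0)"
      by (intro sum.cong refl)
    then show ?thesis
      using M(1) A by (simp add: sum_functional_apply)
  qed
  fix u v assume u: "u \<in> (\<Pi>\<^sub>E U\<in>M. U)" and v: "v \<in> (\<Pi>\<^sub>E U\<in>M. U)"
    and eq: "(\<Sum>U\<in>M. u U) = (\<Sum>U\<in>M. v U)"
  have "u A = v A" if A: "A \<in> M" for A
  proof
    fix x
    show "u A x = v A x"
      using restr[OF u A, of x] restr[OF v A, of x] unfolding eq by simp
  qed
  then show "u = v"
    by (rule PiE_ext[OF u v])
qed

text \<open>
Every member of \<open>G\<close> below \<open>C\<close> lies in a maximal one, so the maximal ones span \<open>C\<close>; it remains to see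
that their supports are disjoint. If \<open>i\<close> is in the support of a maximal element \<open>A\<close>, then \<open>A\<close> contains the
irreducible of the whole block of \<open>i\<close> in \<open>C\<close>, because that irreducible shares a root with \<open>A\<close>. Two maximal
elements with \<open>i\<close> in both supports thus share a root, and their sum, again a member below \<open>C\<close>, equals
both of them.
\<close>

lemma building_if_joins:
  fixes G :: "'n::finite functional set set"
  assumes G: "F_A \<subseteq> G" "G \<subseteq> C_A"
    and joins: "\<And>P Q a b. partition_subspace P \<in> G \<Longrightarrow> partition_subspace Q \<in> G \<Longrightarrow> a \<noteq> b \<Longrightarrow>
      coord_diff a b \<in> partition_subspace P \<Longrightarrow> coord_diff a b \<in> partition_subspace Q \<Longrightarrow>
      partition_subspace (P \<union> Q) \<in> G"
  shows "building G"
proof -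
  have fG: "finite G"
    using G(2) finite_C_A finite_subset by blast
  have form: "\<exists>P. U = partition_subspace P" if "U \<in> G" for U
    using C_A_partition_subspace G(2) that by blast
  have sub: "U \<subseteq> dual_space" "dual.subspace U" "U \<noteq> {0}" if U: "U \<in> G" for U
  proof -
    obtain P where P: "U = partition_subspace P"
      using form[OF U] by blast
    show "U \<subseteq> dual_space" "dual.subspace U"
      unfolding P by (rule partition_subspace_subset_dual, rule subspace_partition_subspace)
    show "U \<noteq> {0}"
      using U G(2) unfolding C_A_def by blast
  qed
  have "is_direct_sum C (max_elements_in G C)" if C: "C \<in> sum_closure G" for C
  proof -
    let ?M = "max_elements_in G C"
    let ?S = "\<lambda>U. {i. \<exists>j. i \<noteq> j \<and> coord_diff i j \<in> U}"
    have MG: "?M \<subseteq> G" and MC: "\<And>A. A \<in> ?M \<Longrightarrow> A \<subseteq> C"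
      and max: "\<And>A B. A \<in> ?M \<Longrightarrow> B \<in> G \<Longrightarrow> B \<subseteq> C \<Longrightarrow> A \<subseteq> B \<Longrightarrow> A = B"
      unfolding max_elements_in_def by auto
    have fM: "finite ?M"
      using MG fG finite_subset by blast
    obtain K where K: "K \<subseteq> G" "C = sum_of K"
      using C unfolding sum_closure_def by blast
    have "C = dual.span (\<Union>K)"
      unfolding K(2) using K(1) fG sub(2) finite_subset by (intro sum_of_eq_span) blast+
    then have sC: "dual.subspace C" and KC: "\<Union>K \<subseteq> C"
      using dual.subspace_span dual.span_superset by blast+
    have "sum_of ?M = dual.span (\<Union>?M)"
      using fM MG sub(2) by (intro sum_of_eq_span) blast+
    also have "\<dots> = C"
    proof
      show "dual.span (\<Union>?M) \<subseteq> C"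
        using MC by (intro dual.span_minimal[OF _ sC]) blast
      have "U \<subseteq> \<Union>?M" if "U \<in> K" for U
      proof -
        have "U \<in> G" "U \<subseteq> C"
          using that K(1) KC by auto
        then obtain A where "A \<in> ?M" "U \<subseteq> A"
          by (rule subset_max_element[OF fG])
        then show ?thesis by blast
      qed
      then have "\<Union>K \<subseteq> dual.span (\<Union>?M)"
        using dual.span_superset[of "\<Union>?M"] by blast
      then show "C \<subseteq> dual.span (\<Union>?M)"
        unfolding \<open>C = dual.span (\<Union>K)\<close> by (rule dual.span_minimal[OF _ dual.subspace_span])
    qed
    finally have image: "sum_of ?M = C" .
    have contains: "partition_subspace {{j. coord_diff i j \<in> C}} \<subseteq> A" if A: "A \<in> ?M" and i: "i \<in> ?S A" for A i
    proof -
      let ?D = "{j. coord_diff i j \<in> C}"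
      obtain j where j: "i \<noteq> j" "coord_diff i j \<in> A"
        using i by blast
      obtain P where P: "A = partition_subspace P"
        using form A MG by blast
      have D: "i \<in> ?D" "j \<in> ?D"
        using j MC[OF A] dual.subspace_0[OF sC] by auto
      then have "card {i, j} \<le> card ?D"
        by (intro card_mono) auto
      then have "1 < card ?D"
        using j(1) by simp
      then have "partition_subspace {?D} \<in> G"
        using G(1) F_A_iff by blast
      moreover have "coord_diff i j \<in> partition_subspace {?D}"
        using D by (intro root_in_partition_subspace[of ?D]) auto
      ultimately have "partition_subspace (P \<union> {?D}) \<in> G"
        using joins[of P "{?D}" i j] A MG j unfolding P by blast
      moreover have DC: "partition_subspace {?D} \<subseteq> C"
      proof (rule partition_subspace_least[OF sC])
        fix B a b assume "B \<in> {?D}" "a \<in> B" "b \<in> B"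
        then have "coord_diff i b \<in> C" "coord_diff i a \<in> C"
          by auto
        then have "coord_diff i b - coord_diff i a \<in> C"
          by (rule dual.subspace_diff[OF sC])
        then show "coord_diff a b \<in> C"
          by simp
      qed
      moreover have "partition_subspace (P \<union> {?D}) \<subseteq> C"
        using MC[OF A] DC unfolding P by (rule partition_subspace_Un_least[OF sC])
      moreover have "A \<subseteq> partition_subspace (P \<union> {?D})"
        unfolding P by (rule partition_subspace_mono) blast
      ultimately have "A = partition_subspace (P \<union> {?D})"
        using max[OF A] by blast
      moreover have "partition_subspace {?D} \<subseteq> partition_subspace (P \<union> {?D})"
        by (rule partition_subspace_mono) blast
      ultimately show ?thesis
        by blast
    qed
    have "?S A \<inter> ?S B = {}" if A: "A \<in> ?M" and B: "B \<in> ?M" and "A \<noteq> B" for A B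
    proof (rule ccontr)
      assume "?S A \<inter> ?S B \<noteq> {}"
      then obtain i where i: "i \<in> ?S A" "i \<in> ?S B"
        by blast
      then obtain j where j: "i \<noteq> j" "coord_diff i j \<in> A"
        by blast
      have "coord_diff i j \<in> C" "coord_diff i i \<in> C"
        using j MC[OF A] dual.subspace_0[OF sC] by auto
      then have "coord_diff i j \<in> partition_subspace {{j. coord_diff i j \<in> C}}"
        by (intro root_in_partition_subspace[of "{j. coord_diff i j \<in> C}"]) auto
      then have jB: "coord_diff i j \<in> B"
        using contains[OF B i(2)] by blast
      obtain P Q where P: "A = partition_subspace P" and Q: "B = partition_subspace Q"
        using form A B MG by blast
      have "partition_subspace (P \<union> Q) \<in> G"
        using joins[of P Q i j] A B MG j jB unfolding P Q by blast
      moreover have "partition_subspace (P \<union> Q) \<subseteq> C"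
        using MC[OF A] MC[OF B] unfolding P Q by (rule partition_subspace_Un_least[OF sC])
      moreover have "A \<subseteq> partition_subspace (P \<union> Q)" "B \<subseteq> partition_subspace (P \<union> Q)"
        unfolding P Q by (rule partition_subspace_mono, blast)+
      ultimately have "A = B"
        using max[OF A] max[OF B] by metis
      then show False
        using \<open>A \<noteq> B\<close> by contradiction
    qed
    moreover have "?M \<subseteq> C_A"
      using MG G(2) by blast
    ultimately have "inj_on (\<lambda>u. \<Sum>U\<in>?M. u U) (\<Pi>\<^sub>E U\<in>?M. U)"
      by (intro disjoint_supports_independent[where S = ?S] fM) blast+
    then show ?thesis
      using image unfolding is_direct_sum_def bij_betw_def sum_of_def by blast
  qed
  then show ?thesis
    unfolding building_def using fG sub by blast
qed

section \<open>The invariant building set of an antichain\<close>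

lemma building_joins:
  assumes G: "building G" "partition_subspace P \<in> G" "partition_subspace Q \<in> G"
    and ab: "a \<noteq> b" "coord_diff a b \<in> partition_subspace P" "coord_diff a b \<in> partition_subspace Q"
  shows "partition_subspace (P \<union> Q) \<in> G"
  using building_span_Un[OF G ab(2,3) root_nonzero[OF ab(1)]] unfolding span_partition_subspace_Un .

text \<open>
A nontrivial block of the join \<open>R\<close> contains a nontrivial member of \<open>P\<close> or of \<open>Q\<close>. In the second case
it is large enough either because that member is, or because it also contains a whole nontrivial block
of \<open>P\<close>.
\<close>

lemma partition_ge_coarser_family:
  fixes P Q R :: "'n::finite set set"
  assumes P: "partition_on UNIV P" and R: "partition_on UNIV R"
    "partition_subspace R = partition_subspace (P \<union> Q)"
    and Y: "Y \<in> P" "1 < card Y" "\<forall>B\<in>P. 1 < card B \<longrightarrow> card Y \<le> card B"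
    and Q: "\<forall>E\<in>Q. 1 < card E \<longrightarrow> card Y \<le> card E \<or> (\<exists>B\<in>P. 1 < card B \<and> B \<inter> E \<noteq> {})"
  shows "partition_ge (block_sizes R) (block_sizes P)"
proof -
  have ref: "refines UNIV P R"
    using partition_subspace_mono[of P "P \<union> Q"] R(2) partition_subspace_subset_iff[OF P R(1)] by auto
  have "card Y \<le> card D" if D: "D \<in> R" "1 < card D" for D
  proof -
    obtain E where E: "E \<in> P \<union> Q" "1 < card E" "E \<subseteq> D"
      using nontrivial_block_from_family[OF R D] by blast
    then have "card Y \<le> card E \<or> (\<exists>B\<in>P. 1 < card B \<and> B \<inter> E \<noteq> {})"
      using Y(3) Q by blast
    then show ?thesis
    proof
      assume "card Y \<le> card E"
      also have "card E \<le> card D"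
        using E(3) by (intro card_mono) auto
      finally show ?thesis .
    next
      assume "\<exists>B\<in>P. 1 < card B \<and> B \<inter> E \<noteq> {}"
      then obtain B x where B: "B \<in> P" "1 < card B" "x \<in> B" "x \<in> E"
        by blast
      then have "B \<subseteq> D"
        using refinesD[OF ref B(1) D(1), of x] E(3) by blast
      then have "card B \<le> card D"
        by (intro card_mono) auto
      then show ?thesis
        using Y(3) B by force
    qed
  qed
  then show ?thesis
    unfolding partition_ge_iff using Y by (intro moves_if_refines[OF finite ref]) auto
qed

lemma G_tilde_iff:
  fixes P :: "'n::finite set set"
  assumes "partition_on UNIV P" "\<exists>B\<in>P. 1 < card B"
  shows "partition_subspace P \<in> G_tilde l \<longleftrightarrow> partition_ge (block_sizes P) l"
  using has_form_iff[OF assms(1)] partition_subspace_in_C_A[OF assms(2)]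
    block_sizes_Partitions[OF finite assms(1)]
  unfolding G_tilde_def by auto

lemma G_antichain_iff:
  "S \<noteq> {} \<Longrightarrow> U \<in> G_antichain S \<longleftrightarrow> U \<in> F_A \<or> (\<exists>l\<in>S. U \<in> G_tilde l)"
  unfolding G_antichain_def G_partition_def by blast

lemma F_A_subset_C_A: "F_A \<subseteq> C_A"
  unfolding F_A_def by blast

lemma G_antichain_subset: "S \<noteq> {} \<Longrightarrow> F_A \<subseteq> G_antichain S \<and> G_antichain S \<subseteq> C_A"
  by (auto simp: G_antichain_def G_partition_def G_tilde_def intro: F_A_subset_C_A[THEN subsetD])

lemma smallest_nontrivial_block:
  fixes P :: "'n::finite set set"
  assumes "\<exists>B\<in>P. 1 < card B"
  obtains Y where "Y \<in> P" "1 < card Y" "\<forall>B\<in>P. 1 < card B \<longrightarrow> card Y \<le> card B"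
  using assms ex_has_least_nat[of "\<lambda>B. B \<in> P \<and> 1 < card B" _ card] by metis

text \<open>
The form of the sum is \<open>\<ge>\<close> that of \<open>P\<close>, hence \<open>\<ge> l\<close>. The condition on \<open>Q\<close> is the one of
\<open>partition_ge_coarser_family\<close>, for \<open>Y\<close> any smallest nontrivial block of \<open>P\<close>.
\<close>

lemma join_in_G_antichain:
  fixes P Q :: "'n::finite set set"
  assumes S: "S \<noteq> {}"
    and P: "partition_on UNIV P" "\<exists>B\<in>P. 1 < card B" "partition_ge (block_sizes P) l" "l \<in> S"
    and Q: "\<forall>Y\<in>P. 1 < card Y \<longrightarrow> (\<forall>B\<in>P. 1 < card B \<longrightarrow> card Y \<le> card B) \<longrightarrow>
      (\<forall>E\<in>Q. 1 < card E \<longrightarrow> card Y \<le> card E \<or> (\<exists>B\<in>P. 1 < card B \<and> B \<inter> E \<noteq> {}))"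
  shows "partition_subspace (P \<union> Q) \<in> G_antichain S"
proof -
  obtain Y where Y: "Y \<in> P" "1 < card Y" "\<forall>B\<in>P. 1 < card B \<longrightarrow> card Y \<le> card B"
    using smallest_nontrivial_block[OF P(2)] .
  obtain R where R: "partition_on UNIV R" "partition_subspace R = partition_subspace (P \<union> Q)"
    by (rule partition_of_family)
  have "partition_ge (block_sizes R) (block_sizes P)"
    using Q Y by (intro partition_ge_coarser_family[OF P(1) R Y]) blast
  then have "partition_ge (block_sizes R) l"
    using P(3) by (rule partition_ge_trans)
  moreover have "\<exists>B\<in>R. 1 < card B"
    using partition_subspace_nonzero_iff[of R] partition_subspace_nonzero_iff[of "P \<union> Q"] P(2)
    unfolding R(2) by blast
  ultimately show ?thesis
    using G_tilde_iff[OF R(1)] G_antichain_iff[OF S] P(4) R(2) by metis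
qed

lemma G_antichain_cases:
  fixes U :: "'n::finite functional set"
  assumes "S \<noteq> {}" "U \<in> G_antichain S"
  shows "(\<exists>D. 1 < card D \<and> U = partition_subspace {D}) \<or>
    (\<exists>P l. partition_on UNIV P \<and> (\<exists>B\<in>P. 1 < card B) \<and> U = partition_subspace P \<and> l \<in> S \<and>
      partition_ge (block_sizes P) l)"
proof (cases "U \<in> F_A")
  case True
  then show ?thesis
    by (intro disjI1) (simp only: F_A_iff)
next
  case False
  then obtain l where l: "l \<in> S" "U \<in> G_tilde l"
    using assms G_antichain_iff by blast
  then have "U \<in> C_A"
    by (simp add: G_tilde_def)
  then obtain P where P: "partition_on UNIV P" "\<exists>B\<in>P. 1 < card B" "U = partition_subspace P"
    by (rule C_A_cases)
  then have "partition_ge (block_sizes P) l"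
    using l(2) G_tilde_iff[OF P(1,2)] by simp
  then show ?thesis
    using P l(1) by (intro disjI2 exI[of _ P] exI[of _ l] conjI)
qed

lemma root_in_single_block:
  assumes "coord_diff a b \<in> partition_subspace {D}" "a \<noteq> b"
  shows "a \<in> D" "b \<in> D"
proof -
  show "a \<in> D"
    using root_in_partition_subspaceD[OF assms] by blast
  have "- coord_diff a b \<in> partition_subspace {D}"
    using assms(1) by (rule dual.subspace_neg[OF subspace_partition_subspace])
  then have "coord_diff b a \<in> partition_subspace {D}"
    by simp
  then show "b \<in> D"
    using root_in_partition_subspaceD[of b a "{D}"] assms(2) by blast
qed

lemma common_root_blocks_meet:
  fixes P :: "'n::finite set set"
  assumes "partition_on UNIV P" "coord_diff a b \<in> partition_subspace P" "coord_diff a b \<in> partition_subspace {D}" "a \<noteq> b"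
  shows "\<exists>B\<in>P. 1 < card B \<and> B \<inter> D \<noteq> {}"
  using root_in_partition_subspaceD[OF assms(2,4)] root_in_single_block[OF assms(3,4)] by blast

lemma partition_subspace_overlapping_blocks:
  assumes "c \<in> D" "c \<in> E"
  shows "partition_subspace {D, E} = partition_subspace {D \<union> E}"
proof
  show "partition_subspace {D, E} \<subseteq> partition_subspace {D \<union> E}"
    by (rule partition_subspace_least[OF subspace_partition_subspace])
      (auto intro: root_in_partition_subspace[of "D \<union> E"])
  show "partition_subspace {D \<union> E} \<subseteq> partition_subspace {D, E}"
  proof (rule partition_subspace_least[OF subspace_partition_subspace])
    have c: "coord_diff x c \<in> partition_subspace {D, E}" if "x \<in> D \<union> E" for x
      using that assms root_in_partition_subspace[of D "{D, E}" x c]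
        root_in_partition_subspace[of E "{D, E}" x c] by auto
    fix B a b assume "B \<in> {D \<union> E}" "a \<in> B" "b \<in> B"
    then have "coord_diff a c - coord_diff b c \<in> partition_subspace {D, E}"
      by (intro dual.subspace_diff[OF subspace_partition_subspace] c) auto
    then show "coord_diff a b \<in> partition_subspace {D, E}"
      by simp
  qed
qed

text \<open>
Two members that come from the sets \<open>G_tilde\<close> are added to the one with the smaller smallest
nontrivial block. If one of the members is irreducible, the common root makes
its block meet a nontrivial block of the other.
\<close>

lemma building_G_antichain:
  assumes S: "S \<noteq> {}"
  shows "building (G_antichain S :: 'n::finite functional set set)"
proof (rule building_if_joins)
  show "F_A \<subseteq> G_antichain S" "G_antichain S \<subseteq> C_A"
    using G_antichain_subset[OF S] by auto
  let ?ge = "\<lambda>(P :: 'n set set). \<exists>l\<in>S. partition_on UNIV P \<and> (\<exists>B\<in>P. 1 < card B) \<and> partition_ge (block_sizes P) l"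
  fix P0 Q0 :: "'n set set" and a b
  assume P0: "partition_subspace P0 \<in> G_antichain S" and Q0: "partition_subspace Q0 \<in> G_antichain S"
    and ab: "a \<noteq> b" "coord_diff a b \<in> partition_subspace P0" "coord_diff a b \<in> partition_subspace Q0"
  have cases: "\<exists>P. partition_subspace P0 = partition_subspace P \<and> (?ge P \<or> (\<exists>D. 1 < card D \<and> P = {D}))"
    if "partition_subspace P0 \<in> G_antichain S" for P0
    using G_antichain_cases[OF S that] by blast
  have mixed: "partition_subspace (P \<union> {D}) \<in> G_antichain S"
    if P: "?ge P" and D: "coord_diff a b \<in> partition_subspace P" "coord_diff a b \<in> partition_subspace {D}" for P D
  proof -
    obtain l where l: "l \<in> S" "partition_on UNIV P" "\<exists>B\<in>P. 1 < card B" "partition_ge (block_sizes P) l"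
      using P by blast
    then show ?thesis
      using common_root_blocks_meet[OF l(2) D ab(1)]
      by (intro join_in_G_antichain[OF S l(2,3,4,1)]) blast
  qed
  have big: "partition_subspace (P \<union> Q) \<in> G_antichain S"
    if P: "?ge P" and Y: "Y \<in> P" "1 < card Y" "\<forall>B\<in>Q. 1 < card B \<longrightarrow> card Y \<le> card B" for P Q Y
  proof -
    obtain l where l: "l \<in> S" "partition_on UNIV P" "\<exists>B\<in>P. 1 < card B" "partition_ge (block_sizes P) l"
      using P by blast
    then show ?thesis
      using Y by (intro join_in_G_antichain[OF S l(2,3,4,1)]) (meson order_trans)
  qed
  obtain P where P: "partition_subspace P0 = partition_subspace P" "?ge P \<or> (\<exists>D. 1 < card D \<and> P = {D})"
    using cases[OF P0] by blast
  obtain Q where Q: "partition_subspace Q0 = partition_subspace Q" "?ge Q \<or> (\<exists>D. 1 < card D \<and> Q = {D})"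
    using cases[OF Q0] by blast
  note ab' = ab(2,3)[unfolded P(1) Q(1)]
  have "partition_subspace (P \<union> Q) \<in> G_antichain S"
    using P(2)
  proof
    assume P': "?ge P"
    show ?thesis
      using Q(2)
    proof
      assume Q': "?ge Q"
      have nt: "\<exists>B\<in>P. 1 < card B" "\<exists>B\<in>Q. 1 < card B"
        using P' Q' by blast+
      obtain Y where Y: "Y \<in> P" "1 < card Y" "\<forall>B\<in>P. 1 < card B \<longrightarrow> card Y \<le> card B"
        by (rule smallest_nontrivial_block[OF nt(1)])
      obtain Z where Z: "Z \<in> Q" "1 < card Z" "\<forall>B\<in>Q. 1 < card B \<longrightarrow> card Z \<le> card B"
        by (rule smallest_nontrivial_block[OF nt(2)])
      show ?thesis
      proof (cases "card Y \<le> card Z")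
        case True
        then show ?thesis
          using Z(3) by (intro big[OF P' Y(1,2)]) (meson order_trans)
      next
        case False
        then have "partition_subspace (Q \<union> P) \<in> G_antichain S"
          using Y(3) by (intro big[OF Q' Z(1,2)]) (meson order_trans nat_le_linear)
        then show ?thesis
          by (simp only: Un_commute)
      qed
    next
      assume "\<exists>D. 1 < card D \<and> Q = {D}"
      then show ?thesis
        using mixed[OF P'] ab' by blast
    qed
  next
    assume "\<exists>D. 1 < card D \<and> P = {D}"
    then obtain D where D: "1 < card D" "P = {D}" by blast
    show ?thesis
      using Q(2)
    proof
      assume Q': "?ge Q"
      have "partition_subspace (Q \<union> {D}) \<in> G_antichain S"
        using mixed[OF Q'] ab' D by blast
      then show ?thesis
        by (simp only: Un_commute D(2))
    next
      assume "\<exists>D. 1 < card D \<and> Q = {D}"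
      then obtain E where E: "Q = {E}" by blast
      have "a \<in> D" "a \<in> E"
        using root_in_single_block(1) ab' ab(1) D E by metis+
      then have "partition_subspace (P \<union> Q) = partition_subspace {D \<union> E}"
        using partition_subspace_overlapping_blocks[of a D E] by (simp add: D(2) E insert_commute)
      moreover have "card D \<le> card (D \<union> E)"
        by (intro card_mono) auto
      then have "1 < card (D \<union> E)"
        using D by simp
      ultimately have "partition_subspace (P \<union> Q) \<in> F_A"
        unfolding F_A_iff by (intro exI[of _ "D \<union> E"] conjI)
      then show ?thesis
        using G_antichain_iff[OF S] by blast
    qed
  qed
  then show "partition_subspace (P0 \<union> Q0) \<in> G_antichain S"
    unfolding span_partition_subspace_Un[symmetric] P(1) Q(1) .
qed

lemma partition_on_image_permutation:
  assumes "\<sigma> permutes UNIV" "partition_on UNIV P"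
  shows "partition_on UNIV ((`) \<sigma> ` P)" "block_sizes ((`) \<sigma> ` P) = block_sizes P"
proof -
  have inj: "inj \<sigma>" "surj \<sigma>"
    using permutes_inj[OF assms(1)] permutes_surj[OF assms(1)] by auto
  have "partition_on (\<sigma> ` UNIV) ((`) \<sigma> ` P - {{}})"
    using assms(2) inj(1) by (intro partition_on_inj_image) auto
  moreover have "{} \<notin> (`) \<sigma> ` P"
    using partition_onD3[OF assms(2)] by auto
  ultimately show "partition_on UNIV ((`) \<sigma> ` P)"
    using inj(2) by simp
  have "inj_on ((`) \<sigma>) P"
    using inj_image_eq_iff[OF inj(1)] by (auto intro: inj_onI)
  then have "mset_set ((`) \<sigma> ` P) = image_mset ((`) \<sigma>) (mset_set P)"
    by (simp add: image_mset_mset_set)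
  moreover have "card (\<sigma> ` B) = card B" for B
    using inj(1) by (intro card_image) (auto intro: inj_on_subset)
  ultimately show "block_sizes ((`) \<sigma> ` P) = block_sizes P"
    unfolding block_sizes_def by (simp add: multiset.map_comp o_def)
qed

lemma invariant_G_antichain:
  assumes S: "S \<noteq> {}"
  shows "S_n_invariant (G_antichain S :: 'n::finite functional set set)"
  unfolding S_n_invariant_def
proof (intro allI impI ballI)
  fix \<sigma> :: "'n \<Rightarrow> 'n" and U :: "'n functional set"
  assume \<sigma>: "\<sigma> permutes UNIV" and U: "U \<in> G_antichain S"
  have card: "card (\<sigma> ` B) = card B" for B
    using permutes_inj[OF \<sigma>] by (intro card_image) (auto intro: inj_on_subset)
  from G_antichain_cases[OF S U] show "perm_act \<sigma> ` U \<in> G_antichain S"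
  proof (elim disjE exE conjE)
    fix D assume D: "1 < card D" "U = partition_subspace {D}"
    then have "perm_act \<sigma> ` U = partition_subspace {\<sigma> ` D}"
      by (simp add: perm_act_partition_subspace)
    moreover have "1 < card (\<sigma> ` D)"
      using D card by simp
    ultimately have "perm_act \<sigma> ` U \<in> F_A"
      unfolding F_A_iff by (intro exI[of _ "\<sigma> ` D"] conjI)
    then show ?thesis
      using G_antichain_iff[OF S] by blast
  next
    fix P l assume P: "partition_on UNIV P" "\<exists>B\<in>P. 1 < card B" "U = partition_subspace P" "l \<in> S"
      "partition_ge (block_sizes P) l"
    have "\<exists>B\<in>(`) \<sigma> ` P. 1 < card B"
      using P(2) card by auto
    then have "partition_subspace ((`) \<sigma> ` P) \<in> G_tilde l"
      using G_tilde_iff[OF partition_on_image_permutation(1)[OF \<sigma> P(1)]] P(5)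
        partition_on_image_permutation(2)[OF \<sigma> P(1)] by metis
    then show ?thesis
      using G_antichain_iff[OF S] P(3,4) perm_act_partition_subspace by metis
  qed
qed

section \<open>The antichain of an invariant building set\<close>

lemma swapping_permutation:
  fixes Y D :: "'n::finite set"
  assumes "card Y = card D" "Y \<inter> D = {}"
  obtains \<sigma> where "\<sigma> permutes UNIV" "\<sigma> ` Y = D" "\<And>x. x \<notin> Y \<Longrightarrow> x \<notin> D \<Longrightarrow> \<sigma> x = x" "\<sigma> ` D = Y"
proof -
  obtain g where g: "bij_betw g Y D"
    using finite_same_card_bij[of Y D] assms(1) by auto
  define h where "h = inv_into Y g"
  have h: "bij_betw h D Y"
    unfolding h_def by (rule bij_betw_inv_into[OF g])
  define \<sigma> where "\<sigma> = (\<lambda>x. if x \<in> Y then g x else if x \<in> D then h x else x)"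
  have gY: "g x \<in> D" "g x \<notin> Y" "h (g x) = x" if "x \<in> Y" for x
    using that bij_betwE[OF g] assms(2) bij_betw_inv_into_left[OF g] unfolding h_def by auto
  have hD: "h x \<in> Y" "h x \<notin> D" "g (h x) = x" if "x \<in> D" for x
    using that bij_betwE[OF h] assms(2) bij_betw_inv_into_right[OF g] unfolding h_def by auto
  have "\<sigma> (\<sigma> x) = x" for x
    using gY hD by (auto simp: \<sigma>_def)
  then have "bij \<sigma>"
    by (rule involuntory_imp_bij)
  then have "\<sigma> permutes UNIV"
    by (rule bij_imp_permutes) simp
  moreover have "\<sigma> ` Y = g ` Y"
    by (rule image_cong) (auto simp: \<sigma>_def)
  moreover have "\<sigma> ` D = h ` D"
    using assms(2) by (intro image_cong) (auto simp: \<sigma>_def)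
  ultimately show ?thesis
    using that[of \<sigma>] bij_betw_imp_surj_on[OF g] bij_betw_imp_surj_on[OF h] by (simp add: \<sigma>_def)
qed

lemma two_points:
  assumes "1 < card B"
  obtains a b where "a \<in> B" "b \<in> B" "a \<noteq> b"
proof -
  have "finite B"
    using assms by (metis card.infinite not_less_zero)
  then show ?thesis
    using card_le_Suc0_iff_eq[of B] assms that by force
qed

text \<open>
The shape in which \<open>building_joins\<close> is used below: a nontrivial block \<open>B \<subseteq> E\<close> supplies the common root.
\<close>

lemma building_joins_block:
  assumes G: "building G" "partition_subspace P \<in> G" "partition_subspace Q \<in> G"
    and B: "B \<in> P" "1 < card B" "E \<in> Q" "B \<subseteq> E"
  shows "partition_subspace (P \<union> Q) \<in> G"
proof -
  obtain a b where ab: "a \<in> B" "b \<in> B" "a \<noteq> b"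
    using two_points[OF B(2)] .
  show ?thesis
  proof (rule building_joins[OF G ab(3)])
    show "coord_diff a b \<in> partition_subspace P"
      using B ab by (intro root_in_partition_subspace)
    show "coord_diff a b \<in> partition_subspace Q"
      using B ab by (intro root_in_partition_subspace[of E]) auto
  qed
qed

lemma single_block_in_F_A: "1 < card D \<Longrightarrow> partition_subspace {D} \<in> F_A"
  unfolding F_A_iff by (intro exI[of _ D] conjI refl)

text \<open>
A permutation \<open>\<sigma>\<close> exchanges \<open>Y\<close> with a subset \<open>D0\<close> of \<open>D\<close> and fixes the other points, in particular \<open>Z\<close>.
Hence the subspaces of \<open>P\<close> and \<open>\<sigma> P\<close> share the roots of \<open>Z\<close> and their sum is in \<open>G\<close>; it contains the
roots of \<open>D0\<close>, so the irreducible of \<open>D\<close> can be added. The result is \<open>partition_subspace (P \<union> {D})\<close>,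
since \<open>\<sigma> P\<close> differs from \<open>P\<close> only by blocks inside \<open>D\<close> and by singletons.
\<close>

lemma invariant_building_adds_block:
  fixes G :: "'n::finite functional set set"
  assumes G: "building G" "S_n_invariant G" "F_A \<subseteq> G"
    and P: "partition_on UNIV P" "partition_subspace P \<in> G"
    and Y: "Y \<in> P" "1 < card Y" and Z: "Z \<in> P" "1 < card Z" "Y \<noteq> Z"
    and D: "card Y \<le> card D" "\<forall>x\<in>D. {x} \<in> P"
  shows "partition_subspace (P \<union> {D}) \<in> G"
proof -
  have disj: "X \<inter> D = {}" if X: "X \<in> P" "1 < card X" for X
  proof (rule ccontr)
    assume "X \<inter> D \<noteq> {}"
    then obtain x where "x \<in> X" "x \<in> D" by blast
    then have "X = {x}"
      using D(2) partition_block_unique[OF P(1) X(1), of "{x}" x] by blast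
    then show False
      using X by simp
  qed
  obtain D0 where D0: "D0 \<subseteq> D" "card D0 = card Y"
    using D(1) obtain_subset_with_card_n by metis
  have "Y \<inter> D0 = {}"
    using disj[OF Y] D0(1) by blast
  then obtain \<sigma> where \<sigma>: "\<sigma> permutes UNIV" "\<sigma> ` Y = D0" "\<And>x. x \<notin> Y \<Longrightarrow> x \<notin> D0 \<Longrightarrow> \<sigma> x = x" "\<sigma> ` D0 = Y"
    using swapping_permutation[of Y D0] D0(2) by metis
  let ?P' = "(`) \<sigma> ` P"
  have fixed: "\<sigma> ` X = X" if X: "X \<in> P" "X \<noteq> Y" "X \<inter> D0 = {}" for X
  proof -
    have "x \<notin> Y \<and> x \<notin> D0" if "x \<in> X" for x
      using partition_block_unique[OF P(1) X(1) Y(1) that] X(2,3) that by blast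
    then have "\<sigma> ` X = id ` X"
      using \<sigma>(3) by (intro image_cong) auto
    then show ?thesis
      by simp
  qed
  have P'G: "partition_subspace ?P' \<in> G"
    using G(2) \<sigma>(1) P(2) unfolding S_n_invariant_def perm_act_partition_subspace[symmetric] by blast
  have "Z \<in> ?P'"
    using fixed[OF Z(1)] Z disj[OF Z(1,2)] D0(1) by (metis image_eqI inf.absorb_iff2 inf_bot_right inf_assoc inf_commute)
  then have PP': "partition_subspace (P \<union> ?P') \<in> G"
    using building_joins_block[OF G(1) P(2) P'G Z(1,2)] by blast
  have D1: "1 < card D0" "1 < card D"
    using D0 Y D by auto
  have "partition_subspace {D} \<in> G"
    using G(3) single_block_in_F_A[OF D1(2)] by blast
  moreover have "D0 \<in> P \<union> ?P'"
    using \<sigma>(2) Y(1) by blast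
  ultimately have "partition_subspace ((P \<union> ?P') \<union> {D}) \<in> G"
    using building_joins_block[OF G(1) PP', of "{D}" D0 D] D1(1) D0(1) by blast
  moreover have "partition_subspace ((P \<union> ?P') \<union> {D}) = partition_subspace (P \<union> {D})"
  proof
    show "partition_subspace (P \<union> {D}) \<subseteq> partition_subspace ((P \<union> ?P') \<union> {D})"
      by (rule partition_subspace_mono) blast
    show "partition_subspace ((P \<union> ?P') \<union> {D}) \<subseteq> partition_subspace (P \<union> {D})"
    proof (rule partition_subspace_least[OF subspace_partition_subspace])
      fix B a b assume B: "B \<in> (P \<union> ?P') \<union> {D}" "a \<in> B" "b \<in> B" "a \<noteq> b"
      have "B \<in> P \<union> {D} \<or> B \<subseteq> D"
      proof (cases "B \<in> ?P'")
        case False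
        then show ?thesis using B(1) by blast
      next
        case True
        then obtain X where X: "X \<in> P" "B = \<sigma> ` X" by blast
        show ?thesis
        proof (cases "X = Y")
          case True
          then show ?thesis using X \<sigma>(2) D0(1) by blast
        next
          case False
          \<comment> \<open>A block meeting \<open>D0\<close> is a singleton, and so is its image \<open>B\<close>, which has two elements.\<close>
          have "X \<inter> D0 = {}"
          proof (rule ccontr)
            assume "X \<inter> D0 \<noteq> {}"
            then obtain x where x: "x \<in> X" "x \<in> D0" by blast
            then have "{x} \<in> P"
              using D(2) D0(1) by blast
            then have "X = {x}"
              using partition_block_unique[OF P(1) X(1) _ x(1)] by blast
            then show False
              using X(2) B by auto
          qed
          then show ?thesis
            using fixed[OF X(1) False] X by simp
        qed
      qed
      then show "coord_diff a b \<in> partition_subspace (P \<union> {D})"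
        using B root_in_partition_subspace[of B "P \<union> {D}" a b] root_in_partition_subspace[of D "P \<union> {D}" a b]
        by blast
    qed
  qed
  ultimately show ?thesis
    by simp
qed

text \<open>
The nontrivial blocks of \<open>Q\<close> can be added to \<open>P\<close> independently of each other, because all the resulting
subspaces contain the roots of \<open>Y\<close> and can therefore be summed.
\<close>

lemma invariant_building_coarsening:
  fixes G :: "'n::finite functional set set"
  assumes G: "building G" "S_n_invariant G" "F_A \<subseteq> G"
    and P: "partition_subspace P \<in> G" and ref: "refines UNIV P Q"
    and Y: "Y \<in> P" "1 < card Y" and Z: "Z \<in> P" "1 < card Z" "Y \<noteq> Z"
    and Q: "\<forall>D\<in>Q. 1 < card D \<longrightarrow> card Y \<le> card D"
  shows "partition_subspace Q \<in> G"
proof -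
  have PU: "partition_on UNIV P" and QU: "partition_on UNIV Q"
    using ref unfolding refines_def by auto
  have add: "partition_subspace (P \<union> {D}) \<in> G" if D: "D \<in> Q" "1 < card D" for D
  proof (cases "\<forall>x\<in>D. {x} \<in> P")
    case True
    then show ?thesis
      using Q D by (intro invariant_building_adds_block[OF G PU P Y Z]) auto
  next
    case False
    then obtain x where x: "x \<in> D" "{x} \<notin> P" by blast
    obtain B where B: "B \<in> P" "x \<in> B"
      using partition_block_cover[OF PU UNIV_I] .
    have "1 < card B"
      using singleton_block_iff[OF finite PU B(1)] B x(2) by auto
    moreover have "B \<subseteq> D"
      using refinesD[OF ref B(1) D(1) B(2) x(1)] .
    moreover have "partition_subspace {D} \<in> G"
      using G(3) single_block_in_F_A[OF D(2)] by blast
    ultimately show ?thesis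
      using building_joins_block[OF G(1) P _ B(1)] by blast
  qed
  have "partition_subspace (P \<union> K) \<in> G" if "finite K" "K \<subseteq> {D \<in> Q. 1 < card D}" for K
    using that
  proof (induction K rule: finite_induct)
    case empty
    then show ?case using P by simp
  next
    case (insert D K)
    then have "partition_subspace (P \<union> K) \<in> G" "partition_subspace (P \<union> {D}) \<in> G"
      using add by auto
    then have "partition_subspace ((P \<union> K) \<union> (P \<union> {D})) \<in> G"
      using Y by (intro building_joins_block[OF G(1), of "P \<union> K" "P \<union> {D}" Y Y]) auto
    moreover have "(P \<union> K) \<union> (P \<union> {D}) = P \<union> insert D K"
      by blast
    ultimately show ?case
      by simp
  qed
  then have "partition_subspace (P \<union> {D \<in> Q. 1 < card D}) \<in> G"
    by simp
  moreover have "partition_subspace (P \<union> {D \<in> Q. 1 < card D}) = partition_subspace Q"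
  proof
    show "partition_subspace (P \<union> {D \<in> Q. 1 < card D}) \<subseteq> partition_subspace Q"
      using ref partition_subspace_subset_iff[OF PU QU] partition_subspace_nontrivial_blocks[of Q]
      by (intro partition_subspace_Un_least[OF subspace_partition_subspace]) auto
    show "partition_subspace Q \<subseteq> partition_subspace (P \<union> {D \<in> Q. 1 < card D})"
      unfolding partition_subspace_nontrivial_blocks[of Q] by (rule partition_subspace_mono) auto
  qed
  ultimately show ?thesis
    by simp
qed

text \<open>
By \<open>refinement_of_moves\<close> some conjugate of the subspace of \<open>Q\<close> is obtained from that of \<open>P\<close> by a
coarsening that respects the size bound.
\<close>

lemma invariant_building_upward_closed:
  fixes G :: "'n::finite functional set set"
  assumes G: "building G" "S_n_invariant G" "F_A \<subseteq> G"
    and P: "partition_on UNIV P" "partition_subspace P \<in> G" "2 \<le> card {B \<in> P. 1 < card B}"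
    and Q: "partition_on UNIV Q" "partition_ge (block_sizes Q) (block_sizes P)"
  shows "partition_subspace Q \<in> G"
proof -
  have "{B \<in> P. 1 < card B} \<noteq> {}"
    using P(3) by (metis card.empty not_numeral_le_zero)
  then have "\<exists>B\<in>P. 1 < card B"
    by blast
  then obtain Y where Y: "Y \<in> P" "1 < card Y" "\<forall>B\<in>P. 1 < card B \<longrightarrow> card Y \<le> card B"
    by (rule smallest_nontrivial_block)
  have "\<not> {B \<in> P. 1 < card B} \<subseteq> {Y}"
    using P(3) card_mono[of "{Y}" "{B \<in> P. 1 < card B}"] by auto
  then obtain Z where Z: "Z \<in> P" "1 < card Z" "Y \<noteq> Z"
    by blast
  obtain R where R: "refines UNIV P R" "block_sizes R = block_sizes Q" "\<forall>X\<in>R. 1 < card X \<longrightarrow> card Y \<le> card X"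
    using refinement_of_moves[OF finite P(1), of "block_sizes Q" "card Y"] Q(2) Y(3)
    unfolding partition_ge_iff by blast
  have RG: "partition_subspace R \<in> G"
    by (rule invariant_building_coarsening[OF G P(2) R(1) Y(1,2) Z R(3)])
  have RU: "partition_on UNIV R"
    using R(1) unfolding refines_def by blast
  obtain \<sigma> where \<sigma>: "bij \<sigma>" "(`) \<sigma> ` R = Q"
    using same_block_sizes_bij[OF finite finite finite RU Q(1) R(2)] by blast
  have "\<sigma> permutes UNIV"
    using \<sigma>(1) by (rule bij_imp_permutes) simp
  then have "perm_act \<sigma> ` partition_subspace R \<in> G"
    using G(2) RG unfolding S_n_invariant_def by blast
  then show ?thesis
    by (simp add: perm_act_partition_subspace \<sigma>(2))
qed

lemma number_of_large_parts:
  assumes "finite P"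
  shows "size {#k \<in># block_sizes P. k \<ge> 2#} = card {B \<in> P. 1 < card B}"
  using assms by (simp add: block_sizes_def filter_mset_image_mset Suc_le_eq numeral_2_eq_2)

lemma block_sizes_single_iff:
  fixes P :: "'n::finite set set"
  assumes "partition_on UNIV P"
  shows "block_sizes P = {#CARD('n)#} \<longleftrightarrow> P = {UNIV}"
proof
  assume "block_sizes P = {#CARD('n)#}"
  then have "card P = 1"
    by (metis block_sizes_def size_image_mset size_mset_set size_single)
  then obtain B where "P = {B}"
    by (rule card_1_singletonE)
  then show "P = {UNIV}"
    using partition_onD1[OF assms] by simp
qed (simp add: block_sizes_def)

lemma Building_Partitions_iff:
  fixes P :: "'n::finite set set"
  assumes "partition_on UNIV P"
  shows "block_sizes P \<in> Building_Partitions CARD('n) \<longleftrightarrow>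
    P = {UNIV} \<or> 2 \<le> card {B \<in> P. 1 < card B}"
  using block_sizes_Partitions[OF finite assms] block_sizes_single_iff[OF assms]
    number_of_large_parts[of P]
  unfolding Building_Partitions_def by auto

lemma obtain_partition_with_form:
  assumes "l \<in> Partitions CARD('n::finite)"
  obtains P :: "'n::finite set set" where "partition_on UNIV P" "block_sizes P = l"
  using partition_with_block_sizes[of "UNIV :: 'n set" l] assms unfolding Partitions_def by auto

lemma nontrivial_block_if_building:
  fixes P :: "'n::finite set set"
  assumes "CARD('n) \<ge> 2" "partition_on UNIV P" "block_sizes P \<in> Building_Partitions CARD('n)"
  shows "\<exists>B\<in>P. 1 < card B"
proof -
  from Building_Partitions_iff[OF assms(2)] assms(3)
  consider "P = {UNIV}" | "2 \<le> card {B \<in> P. 1 < card B}" by blast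
  then show ?thesis
  proof cases
    case 2
    then have "{B \<in> P. 1 < card B} \<noteq> {}"
      by (metis card.empty not_numeral_le_zero)
    then show ?thesis by blast
  qed (use assms(1) in simp)
qed

lemma partition_ge_top:
  assumes "CARD('n::finite) \<ge> 2" "m \<in> Building_Partitions CARD('n)"
  shows "partition_ge {#CARD('n)#} m"
proof -
  obtain P :: "'n set set" where P: "partition_on UNIV P" "block_sizes P = m"
    using obtain_partition_with_form[of m] assms(2) unfolding Building_Partitions_def by blast
  then obtain Y where Y: "Y \<in> P" "1 < card Y"
    using nontrivial_block_if_building assms by blast
  have U: "partition_on (UNIV :: 'n set) {UNIV}"
    by (rule partition_on_space) simp
  have "refines UNIV P {UNIV}"
    using P(1) U unfolding refines_def by blast
  then have "admissible_move\<^sup>*\<^sup>* (block_sizes P) (block_sizes {UNIV :: 'n set})"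
    using Y by (intro moves_if_refines[OF finite]) (auto intro: card_mono)
  then show ?thesis
    using block_sizes_single_iff[OF U] P(2) by (simp add: partition_ge_iff)
qed

lemma partition_in_F_A_iff:
  fixes P :: "'n::finite set set"
  assumes "partition_on UNIV P"
  shows "partition_subspace P \<in> F_A \<longleftrightarrow> card {B \<in> P. 1 < card B} = 1"
proof
  assume "partition_subspace P \<in> F_A"
  then obtain D where D: "1 < card D" "partition_subspace P = partition_subspace {D}"
    unfolding F_A_iff by blast
  obtain Q where Q: "partition_on UNIV Q" "{B \<in> Q. 1 < card B} = {D}"
    using partition_with_block[OF D(1)] .
  have "partition_subspace P = partition_subspace Q"
    using D(2) Q(2) partition_subspace_nontrivial_blocks[of Q] by simp
  then have "P = Q"
    using partition_subspace_eq_iff[OF assms Q(1)] by blast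
  then show "card {B \<in> P. 1 < card B} = 1"
    using Q(2) by simp
next
  assume "card {B \<in> P. 1 < card B} = 1"
  then obtain D where D: "{B \<in> P. 1 < card B} = {D}"
    by (rule card_1_singletonE)
  then have "1 < card D"
    by blast
  moreover have "partition_subspace P = partition_subspace {D}"
    using partition_subspace_nontrivial_blocks[of P] unfolding D .
  ultimately show "partition_subspace P \<in> F_A"
    unfolding F_A_iff by blast
qed

text \<open>
The subspace of a partition of form \<open>l\<close> lies in \<open>G_antichain T\<close>. If it is not irreducible it was put
there by some \<open>m \<in> T\<close>, so \<open>l \<ge> m\<close>. If it is irreducible, membership gives no information, but then
\<open>l = (n)\<close>, which is the top element.
\<close>

lemma G_antichain_subset_dominates:
  assumes n: "CARD('n::finite) \<ge> 2"
    and S: "S \<in> Antichains CARD('n)" and T: "T \<in> Antichains CARD('n)"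
    and sub: "(G_antichain S :: 'n::finite functional set set) \<subseteq> G_antichain T" and l: "l \<in> S"
  shows "\<exists>m\<in>T. partition_ge l m"
proof -
  have ne: "S \<noteq> {}" "T \<noteq> {}" and bp: "S \<subseteq> Building_Partitions CARD('n)" "T \<subseteq> Building_Partitions CARD('n)"
    using S T unfolding Antichains_def by auto
  obtain P :: "'n set set" where P: "partition_on UNIV P" "block_sizes P = l"
    using obtain_partition_with_form[of l] l bp(1) unfolding Building_Partitions_def by blast
  have nt: "\<exists>B\<in>P. 1 < card B"
    using nontrivial_block_if_building[OF n P(1)] P(2) l bp(1) by blast
  show ?thesis
  proof (cases "P = {UNIV}")
    case True
    then have "l = {#CARD('n)#}"
      using block_sizes_single_iff[OF P(1)] P(2) by simp
    then show ?thesis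
      using partition_ge_top[OF n] bp(2) ne(2) by blast
  next
    case False
    then have "2 \<le> card {B \<in> P. 1 < card B}"
      using Building_Partitions_iff[OF P(1)] P(2) l bp(1) by blast
    then have "partition_subspace P \<notin> F_A"
      using partition_in_F_A_iff[OF P(1)] by simp
    moreover have "partition_subspace P \<in> G_tilde l"
      using G_tilde_iff[OF P(1) nt] P(2) by (simp add: partition_ge_def)
    then have "partition_subspace P \<in> G_antichain T"
      using sub G_antichain_iff[OF ne(1)] l by blast
    ultimately show ?thesis
      using G_antichain_iff[OF ne(2)] G_tilde_iff[OF P(1) nt] P(2) by blast
  qed
qed

lemma antichain_subset_if_dominates:
  assumes "S \<in> Antichains n" "\<forall>l\<in>S. \<exists>m\<in>T. partition_ge l m" "\<forall>m\<in>T. \<exists>l\<in>S. partition_ge m l"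
  shows "S \<subseteq> T"
proof
  fix l assume l: "l \<in> S"
  then obtain m where m: "m \<in> T" "partition_ge l m"
    using assms(2) by blast
  then obtain k where k: "k \<in> S" "partition_ge m k"
    using assms(3) by blast
  have "partition_ge l k"
    using m k partition_ge_trans by blast
  then have "l = k"
    using assms(1) l k(1) unfolding Antichains_def pairwise_def by blast
  then show "l \<in> T"
    using m k partition_ge_antisym by blast
qed

lemma inj_on_G_antichain:
  assumes "CARD('n::finite) \<ge> 2"
  shows "inj_on (G_antichain :: nat multiset set \<Rightarrow> 'n::finite functional set set) (Antichains CARD('n))"
proof (rule inj_onI)
  fix S T assume S: "S \<in> Antichains CARD('n)" and T: "T \<in> Antichains CARD('n)"
    and eq: "(G_antichain S :: 'n functional set set) = G_antichain T"
  have ST: "\<forall>l\<in>S. \<exists>m\<in>T. partition_ge l m" and TS: "\<forall>l\<in>T. \<exists>m\<in>S. partition_ge l m"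
    using G_antichain_subset_dominates[OF assms S T] G_antichain_subset_dominates[OF assms T S] eq
    by blast+
  show "S = T"
    using antichain_subset_if_dominates[OF S ST TS] antichain_subset_if_dominates[OF T TS ST] by blast
qed

text \<open>
Take an element of \<open>L\<close> below \<open>l\<close> with the largest number of rows.
\<close>

lemma minimal_partition_below:
  assumes "L \<subseteq> Partitions n" "l \<in> L"
  shows "\<exists>m\<in>L. partition_ge l m \<and> (\<forall>k\<in>L. partition_ge m k \<longrightarrow> k = m)"
proof -
  have size_le: "size m \<le> sum_mset m" if "\<forall>k\<in>#m. 0 < k" for m :: "nat multiset"
    using that by (induction m) auto
  have "size m \<le> n" if "m \<in> L" for m
  proof -
    have "m \<in> Partitions n"
      using that assms(1) by blast
    then show ?thesis
      using size_le[of m] by (simp add: Partitions_def)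
  qed
  then have "\<forall>m. m \<in> L \<and> partition_ge l m \<longrightarrow> size m \<le> n"
    by simp
  moreover have "l \<in> L \<and> partition_ge l l"
    using assms(2) by (simp add: partition_ge_def)
  ultimately have "\<exists>m. (m \<in> L \<and> partition_ge l m) \<and>
      (\<forall>k. k \<in> L \<and> partition_ge l k \<longrightarrow> size k \<le> size m)"
    by (intro ex_has_greatest_nat[where k = l and b = "Suc n"]) (auto simp: less_Suc_eq_le)
  then obtain m where m: "m \<in> L" "partition_ge l m"
    "\<forall>k. k \<in> L \<and> partition_ge l k \<longrightarrow> size k \<le> size m"
    by blast
  have "k = m" if k: "k \<in> L" "partition_ge m k" for k
  proof -
    have "size k \<le> size m"
      using m(3) k partition_ge_trans[OF m(2) k(2)] by blast
    then show ?thesis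
      using admissible_moves_size[of k m] k(2) unfolding partition_ge_iff by auto
  qed
  then show ?thesis
    using m by blast
qed

text \<open>
The preimage of \<open>B\<close> consists of the minimal building partitions among the forms of the members of \<open>B\<close>.
Members of \<open>B\<close> whose form is not a building partition are irreducible, hence in every \<open>G_antichain S\<close>.
\<close>

lemma invariant_building_is_G_antichain:
  fixes B :: "'n::finite functional set set"
  assumes n: "CARD('n) \<ge> 2" and B: "building B" "S_n_invariant B" "F_A \<subseteq> B" "B \<subseteq> C_A"
  shows "B \<in> G_antichain ` Antichains CARD('n)"
proof -
  define L where "L = {block_sizes P |P. partition_on UNIV P \<and> partition_subspace P \<in> B} \<inter>
    Building_Partitions CARD('n)"
  define S where "S = {l \<in> L. \<forall>m\<in>L. partition_ge l m \<longrightarrow> m = l}"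
  have Lsub: "L \<subseteq> Partitions CARD('n)"
    unfolding L_def Building_Partitions_def by blast
  have below: "\<exists>m\<in>S. partition_ge l m" if "l \<in> L" for l
    using minimal_partition_below[OF Lsub that] unfolding S_def by blast
  have U: "partition_on UNIV {UNIV :: 'n set}"
    by (rule partition_on_space) simp
  have "partition_subspace {UNIV :: 'n set} \<in> F_A"
    using n by (intro single_block_in_F_A) simp
  then have "block_sizes {UNIV :: 'n set} \<in> L"
    using U B(3) Building_Partitions_iff[OF U] unfolding L_def by blast
  then have Sne: "S \<noteq> {}"
    using below by blast
  moreover have "S \<subseteq> Building_Partitions CARD('n)"
    unfolding S_def L_def by blast
  moreover have "pairwise (\<lambda>l m. \<not> partition_ge l m \<and> \<not> partition_ge m l) S"
    unfolding pairwise_def S_def by blast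
  ultimately have S: "S \<in> Antichains CARD('n)"
    unfolding Antichains_def by blast
  have "G_antichain S = B"
  proof
    show "G_antichain S \<subseteq> B"
    proof
      fix W assume W: "W \<in> (G_antichain S :: 'n functional set set)"
      show "W \<in> B"
        using G_antichain_cases[OF Sne W]
      proof (elim disjE exE conjE)
        fix D assume D: "1 < card D" "W = partition_subspace {D}"
        show ?thesis
          using B(3) single_block_in_F_A[OF D(1)] D(2) by blast
      next
        fix Q l assume Q: "partition_on UNIV Q" "\<exists>B\<in>Q. 1 < card B" "W = partition_subspace Q" "l \<in> S"
          "partition_ge (block_sizes Q) l"
        obtain P where P: "partition_on UNIV P" "partition_subspace P \<in> B" "l = block_sizes P"
          using Q(4) unfolding S_def L_def by blast
        have "block_sizes P \<in> Building_Partitions CARD('n)"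
          using Q(4) P(3) unfolding S_def L_def by simp
        then consider "P = {UNIV}" | "2 \<le> card {B \<in> P. 1 < card B}"
          using Building_Partitions_iff[OF P(1)] by blast
        then show ?thesis
        proof cases
          \<comment> \<open>The top form \<open>(n)\<close> has no second nontrivial block, but nothing lies strictly above it.\<close>
          case 1
          then obtain R :: "'n set set" where R: "refines UNIV {UNIV} R" "block_sizes R = block_sizes Q"
            using refinement_of_moves[OF finite U, of "block_sizes Q" 0] Q(5) P(3)
            unfolding partition_ge_iff by auto
          have "refines UNIV R {UNIV}"
            using R(1) unfolding refines_def by blast
          then have "R = {UNIV}"
            using refines_asym R(1) by blast
          then have "Q = {UNIV}"
            using R(2) block_sizes_single_iff[OF Q(1)] block_sizes_single_iff[OF U] by simp
          then show ?thesis
            using P(2) 1 Q(3) by simp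
        next
          case 2
          then show ?thesis
            using invariant_building_upward_closed[OF B(1-3) P(1,2) _ Q(1)] Q(3,5) P(3) by blast
        qed
      qed
    qed
    show "B \<subseteq> G_antichain S"
    proof
      fix W assume W: "W \<in> B"
      then have "W \<in> C_A"
        using B(4) by blast
      then obtain P where P: "partition_on UNIV P" "\<exists>B\<in>P. 1 < card B" "W = partition_subspace P"
        by (rule C_A_cases)
      show "W \<in> G_antichain S"
      proof (cases "2 \<le> card {B \<in> P. 1 < card B}")
        case True
        then have "block_sizes P \<in> L"
          using Building_Partitions_iff[OF P(1)] P(1,3) W unfolding L_def by blast
        then obtain m where "m \<in> S" "partition_ge (block_sizes P) m"
          using below by blast
        then show ?thesis
          using G_antichain_iff[OF Sne] G_tilde_iff[OF P(1,2)] P(3) by blast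
      next
        case False
        moreover have "{B \<in> P. 1 < card B} \<noteq> {}"
          using P(2) by blast
        then have "card {B \<in> P. 1 < card B} \<noteq> 0"
          by simp
        ultimately have "card {B \<in> P. 1 < card B} = 1"
          by linarith
        then show ?thesis
          using partition_in_F_A_iff[OF P(1)] P(3) G_antichain_iff[OF Sne] by blast
      qed
    qed
  qed
  then show ?thesis
    using S by (rule image_eqI[OF sym])
qed

theorem theorem4p1:
  assumes "CARD('n::finite) \<ge> 2"
  shows "bij_betw (G_antichain :: nat multiset set \<Rightarrow> 'n functional set set)
    (Antichains CARD('n))
    {B. building B \<and> S_n_invariant B \<and> F_A \<subseteq> B \<and> B \<subseteq> C_A}"
  unfolding bij_betw_def
proof
  show "inj_on (G_antichain :: nat multiset set \<Rightarrow> 'n functional set set) (Antichains CARD('n))"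
    by (rule inj_on_G_antichain[OF assms])
  show "G_antichain ` Antichains CARD('n) =
    {B :: 'n functional set set. building B \<and> S_n_invariant B \<and> F_A \<subseteq> B \<and> B \<subseteq> C_A}"
  proof
    show "G_antichain ` Antichains CARD('n) \<subseteq>
      {B :: 'n functional set set. building B \<and> S_n_invariant B \<and> F_A \<subseteq> B \<and> B \<subseteq> C_A}"
    proof (intro image_subsetI CollectI conjI)
      fix S assume "S \<in> Antichains CARD('n)"
      then have S: "S \<noteq> {}"
        unfolding Antichains_def by blast
      show "building (G_antichain S :: 'n functional set set)"
        "S_n_invariant (G_antichain S :: 'n functional set set)"
        "F_A \<subseteq> (G_antichain S :: 'n functional set set)"
        "G_antichain S \<subseteq> (C_A :: 'n functional set set)"
        using building_G_antichain[OF S] invariant_G_antichain[OF S] G_antichain_subset[OF S] by auto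
    qed
    show "{B :: 'n functional set set. building B \<and> S_n_invariant B \<and> F_A \<subseteq> B \<and> B \<subseteq> C_A} \<subseteq>
      G_antichain ` Antichains CARD('n)"
    proof
      fix B :: "'n functional set set"
      assume "B \<in> {B. building B \<and> S_n_invariant B \<and> F_A \<subseteq> B \<and> B \<subseteq> C_A}"
      then have B: "building B" "S_n_invariant B" "F_A \<subseteq> B" "B \<subseteq> C_A"
        by auto
      show "B \<in> G_antichain ` Antichains CARD('n)"
        by (rule invariant_building_is_G_antichain[OF assms B])
    qed
  qed
qed

end
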